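(* Let $(H,\mu_H,\Delta_H,\alpha_H)$ be a Hom-bialgebra such that $\alpha_H$ is bijective and let $(M,\alpha_M)$, $(N,\alpha_N)$, $(P,\alpha_P)$ be three objects in ${}_H^H\mathcal{YD}$. For objects $X,Y$ of ${}_H^H\mathcal{YD}$ let $c_{X,Y}:X\otimes Y\to Y\otimes X$, $c_{X,Y}(x\otimes y)=\alpha_Y^{-1}(\alpha_H^{-1}(x_{(-1)})\cdot y)\otimes\alpha_X^{-1}(x_{(0)})$. Then $c$ satisfies the braid relation $$(id_P\otimes c_{M,N})\circ(c_{M,P}\otimes id_N)\circ(id_M\otimes c_{N,P})=(c_{N,P}\otimes id_M)\circ(id_N\otimes c_{M,P})\circ(c_{M,N}\otimes id_P).$$
   Context: Everything is over a field $k$, $\otimes=\otimes_k$; (co)algebras are not assumed (co)unital. Sweedler notation: $\Delta(h)=h_1\otimes h_2$; multiplications are written by juxtaposition. A Hom-bialgebra is $(H,\mu,\Delta,\alpha)$ with $\mu:H\otimes H\to H$, $\Delta:H\to H\otimes H$, $\alpha:H\to H$ linear such that for all $h,h',h''$: $\alpha(hh')=\alpha(h)\alpha(h')$; $\alpha(h)(h'h'')=(hh')\alpha(h'')$; $\Delta(h_1)\otimes\alpha(h_2)=\alpha(h_1)\otimes\Delta(h_2)$; $\Delta(hh')=h_1h'_1\otimes h_2h'_2$; $\Delta(\alpha(h))=\alpha(h_1)\otimes\alpha(h_2)$. Let $(H,\mu_H,\Delta_H,\alpha_H)$ be a Hom-bialgebra, $M$ a linear space, $\alpha_M:M\to M$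 linear. $(M,\alpha_M)$ is a left $H$-module if there is a linear map $H\otimes M\to M$, $h\otimes m\mapsto h\cdot m$, with $\alpha_M(h\cdot m)=\alpha_H(h)\cdot\alpha_M(m)$ and $\alpha_H(h)\cdot(h'\cdot m)=(hh')\cdot\alpha_M(m)$. It is a left $H$-comodule if there is a linear map $\lambda:M\to H\otimes M$, $\lambda(m)=m_{(-1)}\otimes m_{(0)}$, with $(\alpha_H\otimes\alpha_M)\circ\lambda=\lambda\circ\alpha_M$ and $(\Delta_H\otimes\alpha_M)\circ\lambda=(\alpha_H\otimes\lambda)\circ\lambda$. $(M,\alpha_M)$ is a (left-left) Yetter-Drinfeld module over $H$ if it is both a left $H$-module and a left $H$-comodule and, for all $h\in H$, $m\in M$, $$(h_1\cdot m)_{(-1)}\alpha_H^2(h_2)\otimes(h_1\cdot m)_{(0)}=\alpha_H^2(h_1)\alpha_H(m_{(-1)})\otimes\alpha_H(h_2)\cdot m_{(0)}.$$ For $\alpha_H$ bijective, the objects of ${}_H^H\mathcal{YD}$ are the Yetter-Drinfeld modules $(M,\alpha_M)$ over $H$ with $\alpha_M$ bijective (morphisms: linear maps that commute with the structure maps, the actions and the coactions). *)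

theory Defs
  imports "HOL-Algebra.QuotRing" "Jordan_Normal_Form.Missing_VectorSpace"
begin

section \<open>Tensor products of vector spaces\<close>

text \<open>Vector spaces are \<open>module\<close> records. Such a record inherits \<open>mult\<close> and
  \<open>one\<close> from \<open>ring\<close>; these two fields play no role here.\<close>

definition free_space :: "('k, 'r) ring_scheme \<Rightarrow> 's set \<Rightarrow> ('k, 's \<Rightarrow> 'k) module"
  where "free_space K S = (ring.func_space K S)
    \<lparr>carrier := {f \<in> S \<rightarrow>\<^sub>E carrier K. finite {s \<in> S. f s \<noteq> \<zero>\<^bsub>K\<^esub>}}\<rparr>"

definition free_gen :: "('k, 'r) ring_scheme \<Rightarrow> 's set \<Rightarrow> 's \<Rightarrow> 's \<Rightarrow> 'k"
  where "free_gen K S s = (\<lambda>t\<in>S. if t = s then \<one>\<^bsub>K\<^esub> else \<zero>\<^bsub>K\<^esub>)"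

definition free_eval ::
  "('k, 'r) ring_scheme \<Rightarrow> 's set \<Rightarrow> ('k, 'v, 'w) module_scheme \<Rightarrow> ('s \<Rightarrow> 'v) \<Rightarrow> ('s \<Rightarrow> 'k) \<Rightarrow> 'v"
  where "free_eval K S V g f = (\<Oplus>\<^bsub>V\<^esub>s\<in>{s \<in> S. f s \<noteq> \<zero>\<^bsub>K\<^esub>}. f s \<odot>\<^bsub>V\<^esub> g s)"

definition quot_space :: "('k, 'v, 'w) module_scheme \<Rightarrow> 'v set \<Rightarrow> ('k, 'v set) module"
  where "quot_space V W =
    \<lparr>carrier = a_rcosets\<^bsub>V\<^esub> W, mult = undefined, one = undefined,
     zero = W, add = set_add V, smult = (\<lambda>a X. \<Union>x\<in>X. W +>\<^bsub>V\<^esub> (a \<odot>\<^bsub>V\<^esub> x))\<rparr>"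

context
  fixes K :: "('k, 'r) ring_scheme"
    and M :: "('k, 'm, 'u) module_scheme"
    and N :: "('k, 'n, 'v) module_scheme"
begin

definition pair_space :: "('k, 'm \<times> 'n \<Rightarrow> 'k) module"
  where "pair_space = free_space K (carrier M \<times> carrier N)"

definition pair_gen :: "'m \<Rightarrow> 'n \<Rightarrow> 'm \<times> 'n \<Rightarrow> 'k"
  where "pair_gen x y = free_gen K (carrier M \<times> carrier N) (x, y)"

definition tensor_rels :: "('m \<times> 'n \<Rightarrow> 'k) set"
  where "tensor_rels =
    {pair_gen (x \<oplus>\<^bsub>M\<^esub> x') y \<ominus>\<^bsub>pair_space\<^esub> (pair_gen x y \<oplus>\<^bsub>pair_space\<^esub> pair_gen x' y) | x x' y.
       x \<in> carrier M \<and> x' \<in> carrier M \<and> y \<in> carrier N} \<union>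
    {pair_gen x (y \<oplus>\<^bsub>N\<^esub> y') \<ominus>\<^bsub>pair_space\<^esub> (pair_gen x y \<oplus>\<^bsub>pair_space\<^esub> pair_gen x y') | x y y'.
       x \<in> carrier M \<and> y \<in> carrier N \<and> y' \<in> carrier N} \<union>
    {pair_gen (a \<odot>\<^bsub>M\<^esub> x) y \<ominus>\<^bsub>pair_space\<^esub> (a \<odot>\<^bsub>pair_space\<^esub> pair_gen x y) | a x y.
       a \<in> carrier K \<and> x \<in> carrier M \<and> y \<in> carrier N} \<union>
    {pair_gen x (a \<odot>\<^bsub>N\<^esub> y) \<ominus>\<^bsub>pair_space\<^esub> (a \<odot>\<^bsub>pair_space\<^esub> pair_gen x y) | a x y.
       a \<in> carrier K \<and> x \<in> carrier M \<and> y \<in> carrier N}"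

definition tensor_null :: "('m \<times> 'n \<Rightarrow> 'k) set"
  where "tensor_null = LinearCombinations.module.span K pair_space tensor_rels"

definition tensor :: "('k, ('m \<times> 'n \<Rightarrow> 'k) set) module"
  where "tensor = quot_space pair_space tensor_null"

definition tens :: "'m \<Rightarrow> 'n \<Rightarrow> ('m \<times> 'n \<Rightarrow> 'k) set"
  where "tens x y = tensor_null +>\<^bsub>pair_space\<^esub> pair_gen x y"

text \<open>\<open>tlift K M N V f\<close> is the linear map on the tensor product of \<open>M\<close> and \<open>N\<close> induced by a
  bilinear \<open>f\<close>: all formal sums in one coset have the same value under \<open>f\<close>
  (see \<open>tlift_hom\<close>, \<open>tlift_tens\<close> and \<open>tensor_hom_eqI\<close> below).
  It also renders Sweedler notation: an expression \<open>f h\<^sub>1 h\<^sub>2\<close>, where \<open>h\<^sub>1\<close>, \<open>h\<^sub>2\<close> are the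
  Sweedler components of a tensor \<open>t\<close>, is \<open>tlift K H H V f t\<close>.\<close>

definition tlift :: "('k, 'a, 'w) module_scheme \<Rightarrow> ('m \<Rightarrow> 'n \<Rightarrow> 'a) \<Rightarrow> ('m \<times> 'n \<Rightarrow> 'k) set \<Rightarrow> 'a"
  where "tlift V f X =
    the_elem (free_eval K (carrier M \<times> carrier N) V (\<lambda>p. f (fst p) (snd p)) ` X)"

end

notation tensor (infixr \<open>\<boxtimes>\<index>\<close> 75)

subsection \<open>The universal property\<close>

lemma free_space_carrier:
  "carrier (free_space K S) = {f \<in> S \<rightarrow>\<^sub>E carrier K. finite {s \<in> S. f s \<noteq> \<zero>\<^bsub>K\<^esub>}}"
  by (simp add: free_space_def)

lemma free_space_ops:
  assumes "ring K"
  shows "\<zero>\<^bsub>free_space K S\<^esub> = (\<lambda>s\<in>S. \<zero>\<^bsub>K\<^esub>)"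
    and "f \<oplus>\<^bsub>free_space K S\<^esub> g = (\<lambda>s\<in>S. f s \<oplus>\<^bsub>K\<^esub> g s)"
    and "a \<odot>\<^bsub>free_space K S\<^esub> f = (\<lambda>s\<in>S. a \<otimes>\<^bsub>K\<^esub> f s)"
  using assms by (simp_all add: free_space_def ring.func_space_def)

lemma free_space_module:
  assumes "cring K"
  shows "module K (free_space K S)"
proof -
  interpret K: cring K by fact
  interpret F: module K "K.func_space S" by (rule K.func_space_is_module)
  have "LinearCombinations.submodule K (carrier (free_space K S)) (K.func_space S)"
  proof
    show "carrier (free_space K S) \<subseteq> carrier (K.func_space S)"
      by (auto simp: free_space_carrier K.func_space_def)
    show "\<zero>\<^bsub>K.func_space S\<^esub> \<in> carrier (free_space K S)"
      by (auto simp: free_space_carrier K.func_space_def)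
  next
    fix v w assume v: "v \<in> carrier (free_space K S)" and w: "w \<in> carrier (free_space K S)"
    have "{s \<in> S. v s \<oplus>\<^bsub>K\<^esub> w s \<noteq> \<zero>\<^bsub>K\<^esub>} \<subseteq> {s \<in> S. v s \<noteq> \<zero>\<^bsub>K\<^esub>} \<union> {s \<in> S. w s \<noteq> \<zero>\<^bsub>K\<^esub>}"
      by auto
    with v w have "finite {s \<in> S. v s \<oplus>\<^bsub>K\<^esub> w s \<noteq> \<zero>\<^bsub>K\<^esub>}"
      by (auto simp: free_space_carrier intro: finite_subset)
    with v w show "v \<oplus>\<^bsub>K.func_space S\<^esub> w \<in> carrier (free_space K S)"
      by (auto simp: free_space_carrier K.func_space_def cong: conj_cong)
  next
    fix c v assume c: "c \<in> carrier K" and v: "v \<in> carrier (free_space K S)"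
    have "{s \<in> S. c \<otimes>\<^bsub>K\<^esub> v s \<noteq> \<zero>\<^bsub>K\<^esub>} \<subseteq> {s \<in> S. v s \<noteq> \<zero>\<^bsub>K\<^esub>}"
      using c by auto
    with v have "finite {s \<in> S. c \<otimes>\<^bsub>K\<^esub> v s \<noteq> \<zero>\<^bsub>K\<^esub>}"
      by (auto simp: free_space_carrier intro: finite_subset)
    with c v show "c \<odot>\<^bsub>K.func_space S\<^esub> v \<in> carrier (free_space K S)"
      by (auto simp: free_space_carrier K.func_space_def cong: conj_cong)
  qed
  from F.submodule_is_module[OF this] show ?thesis
    by (simp add: free_space_def)
qed

lemma free_gen_closed:
  assumes "cring K" "s \<in> S"
  shows "free_gen K S s \<in> carrier (free_space K S)"
proof -
  interpret K: cring K by fact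
  have "{t \<in> S. (if t = s then \<one>\<^bsub>K\<^esub> else \<zero>\<^bsub>K\<^esub>) \<noteq> \<zero>\<^bsub>K\<^esub>} \<subseteq> {s}" by auto
  then have "finite {t \<in> S. (if t = s then \<one>\<^bsub>K\<^esub> else \<zero>\<^bsub>K\<^esub>) \<noteq> \<zero>\<^bsub>K\<^esub>}"
    by (rule finite_subset) simp
  then show ?thesis by (auto simp: free_space_carrier free_gen_def cong: conj_cong)
qed

lemma free_eval_superset:
  assumes "module K V" "g \<in> S \<rightarrow> carrier V" "s \<in> S \<rightarrow> carrier K"
    "finite T" "T \<subseteq> S" "{p \<in> S. s p \<noteq> \<zero>\<^bsub>K\<^esub>} \<subseteq> T"
  shows "free_eval K S V g s = (\<Oplus>\<^bsub>V\<^esub>p\<in>T. s p \<odot>\<^bsub>V\<^esub> g p)"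
proof -
  interpret V: module K V by fact
  show ?thesis unfolding free_eval_def
  proof (rule V.add.finprod_mono_neutral_cong_left)
    show "\<And>i. i \<in> T - {p \<in> S. s p \<noteq> \<zero>\<^bsub>K\<^esub>} \<Longrightarrow> s i \<odot>\<^bsub>V\<^esub> g i = \<zero>\<^bsub>V\<^esub>"
      using assms(2,5) by (metis (mono_tags, lifting) DiffE PiE V.smult_l_null mem_Collect_eq subsetD)
  qed (use assms in auto)
qed

lemma free_eval_hom:
  assumes "module K V" "g \<in> S \<rightarrow> carrier V"
  shows "free_eval K S V g \<in> module_hom K (free_space K S) V"
proof -
  interpret V: module K V by fact
  have sc: "s \<in> S \<rightarrow> carrier K" "finite {p \<in> S. s p \<noteq> \<zero>\<^bsub>K\<^esub>}" if "s \<in> carrier (free_space K S)" for s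
    using that by (auto simp: free_space_carrier)
  interpret F: module K "free_space K S" by (rule free_space_module) (rule V.R.is_cring)
  show ?thesis unfolding module_hom_def
  proof (intro CollectI conjI allI impI; (elim conjE)?)
    show "free_eval K S V g \<in> carrier (free_space K S) \<rightarrow> carrier V"
      using assms sc by (auto simp: free_eval_def Pi_def intro!: V.finsum_closed)
  next
    fix s t assume s: "s \<in> carrier (free_space K S)" and t: "t \<in> carrier (free_space K S)"
    let ?T = "{p \<in> S. s p \<noteq> \<zero>\<^bsub>K\<^esub>} \<union> {p \<in> S. t p \<noteq> \<zero>\<^bsub>K\<^esub>}"
    have T: "finite ?T" "?T \<subseteq> S" using sc s t by auto
    have st: "s \<oplus>\<^bsub>free_space K S\<^esub> t \<in> carrier (free_space K S)" using s t by simp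
    have "free_eval K S V g (s \<oplus>\<^bsub>free_space K S\<^esub> t) = (\<Oplus>\<^bsub>V\<^esub>p\<in>?T. (s \<oplus>\<^bsub>free_space K S\<^esub> t) p \<odot>\<^bsub>V\<^esub> g p)"
      by (rule free_eval_superset[OF assms sc(1)[OF st] T]) (auto simp: free_space_ops[OF V.R.ring_axioms])
    also have "\<dots> = (\<Oplus>\<^bsub>V\<^esub>p\<in>?T. s p \<odot>\<^bsub>V\<^esub> g p \<oplus>\<^bsub>V\<^esub> t p \<odot>\<^bsub>V\<^esub> g p)"
      using sc(1)[OF s] sc(1)[OF t] assms(2)
      by (intro V.finsum_cong') (auto simp: free_space_ops[OF V.R.ring_axioms] Pi_def V.smult_l_distr)
    also have "\<dots> = (\<Oplus>\<^bsub>V\<^esub>p\<in>?T. s p \<odot>\<^bsub>V\<^esub> g p) \<oplus>\<^bsub>V\<^esub> (\<Oplus>\<^bsub>V\<^esub>p\<in>?T. t p \<odot>\<^bsub>V\<^esub> g p)"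
      using sc(1)[OF s] sc(1)[OF t] assms(2) by (intro V.finsum_addf) (auto simp: Pi_def)
    also have "\<dots> = free_eval K S V g s \<oplus>\<^bsub>V\<^esub> free_eval K S V g t"
      using free_eval_superset[OF assms sc(1)[OF s] T] free_eval_superset[OF assms sc(1)[OF t] T] by simp
    finally show "free_eval K S V g (s \<oplus>\<^bsub>free_space K S\<^esub> t) = free_eval K S V g s \<oplus>\<^bsub>V\<^esub> free_eval K S V g t" .
  next
    fix a s assume a: "a \<in> carrier K" and s: "s \<in> carrier (free_space K S)"
    let ?T = "{p \<in> S. s p \<noteq> \<zero>\<^bsub>K\<^esub>}"
    have T: "finite ?T" "?T \<subseteq> S" using sc s by auto
    have as: "a \<odot>\<^bsub>free_space K S\<^esub> s \<in> carrier (free_space K S)" using a s by simp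
    have "free_eval K S V g (a \<odot>\<^bsub>free_space K S\<^esub> s) = (\<Oplus>\<^bsub>V\<^esub>p\<in>?T. (a \<odot>\<^bsub>free_space K S\<^esub> s) p \<odot>\<^bsub>V\<^esub> g p)"
      by (rule free_eval_superset[OF assms sc(1)[OF as] T]) (use a in \<open>auto simp: free_space_ops[OF V.R.ring_axioms]\<close>)
    also have "\<dots> = (\<Oplus>\<^bsub>V\<^esub>p\<in>?T. a \<odot>\<^bsub>V\<^esub> (s p \<odot>\<^bsub>V\<^esub> g p))"
      using sc(1)[OF s] a assms(2)
      by (intro V.finsum_cong') (auto simp: free_space_ops[OF V.R.ring_axioms] Pi_def V.smult_assoc1)
    also have "\<dots> = a \<odot>\<^bsub>V\<^esub> (\<Oplus>\<^bsub>V\<^esub>p\<in>?T. s p \<odot>\<^bsub>V\<^esub> g p)"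
      using sc(1)[OF s] a assms(2) T by (intro V.finsum_smult_ldistr[symmetric]) (auto simp: Pi_def)
    finally show "free_eval K S V g (a \<odot>\<^bsub>free_space K S\<^esub> s) = a \<odot>\<^bsub>V\<^esub> free_eval K S V g s" by (simp add: free_eval_def)
  qed
qed

lemma free_eval_gen:
  assumes "module K V" "g \<in> S \<rightarrow> carrier V" "p \<in> S"
  shows "free_eval K S V g (free_gen K S p) = g p"
proof -
  interpret V: module K V by fact
  have "free_eval K S V g (free_gen K S p) = (\<Oplus>\<^bsub>V\<^esub>q\<in>{p}. free_gen K S p q \<odot>\<^bsub>V\<^esub> g q)"
    by (rule free_eval_superset[OF assms(1,2)]) (use assms(3) in \<open>auto simp: free_gen_def\<close>)
  also have "\<dots> = g p" using assms by (auto simp: free_gen_def Pi_def)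
  finally show ?thesis .
qed

lemma free_hom_eqI:
  assumes "module K V" "f \<in> module_hom K (free_space K S) V" "g \<in> module_hom K (free_space K S) V"
    and eq: "\<And>p. p \<in> S \<Longrightarrow> f (free_gen K S p) = g (free_gen K S p)"
    and "s \<in> carrier (free_space K S)"
  shows "f s = g s"
proof -
  interpret V: module K V by fact
  interpret F: module K "free_space K S" by (rule free_space_module) (rule V.R.is_cring)
  interpret f: mod_hom K "free_space K S" V f by unfold_locales fact
  interpret g: mod_hom K "free_space K S" V g by unfold_locales fact
  have "\<forall>s \<in> carrier (free_space K S). {p \<in> S. s p \<noteq> \<zero>\<^bsub>K\<^esub>} \<subseteq> A \<longrightarrow> f s = g s" if "finite A" "A \<subseteq> S" for A
    using that
  proof (induction A)
    case empty
    show ?case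
    proof (intro ballI impI)
      fix s assume s: "s \<in> carrier (free_space K S)" "{p \<in> S. s p \<noteq> \<zero>\<^bsub>K\<^esub>} \<subseteq> {}"
      then have "s = \<zero>\<^bsub>free_space K S\<^esub>"
        by (auto simp: free_space_ops[OF V.R.ring_axioms] free_space_carrier PiE_def extensional_def restrict_def)
      then show "f s = g s" by (simp del: free_space_ops)
    qed
  next
    case (insert p A)
    show ?case
    proof (intro ballI impI)
      fix s assume s: "s \<in> carrier (free_space K S)" "{q \<in> S. s q \<noteq> \<zero>\<^bsub>K\<^esub>} \<subseteq> insert p A"
      have p: "p \<in> S" using insert by auto
      have sp: "s \<in> S \<rightarrow>\<^sub>E carrier K" using s by (auto simp: free_space_carrier)
      let ?u = "s(p := \<zero>\<^bsub>K\<^esub>)"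
      have "{q \<in> S. ?u q \<noteq> \<zero>\<^bsub>K\<^esub>} \<subseteq> A" using s insert by auto
      moreover have u: "?u \<in> carrier (free_space K S)"
      proof -
        have "finite {q \<in> S. ?u q \<noteq> \<zero>\<^bsub>K\<^esub>}"
          using \<open>{q \<in> S. ?u q \<noteq> \<zero>\<^bsub>K\<^esub>} \<subseteq> A\<close> insert(1) by (rule finite_subset)
        with sp p show ?thesis by (auto simp: free_space_carrier PiE_def extensional_def Pi_def)
      qed
      ultimately have fu: "f ?u = g ?u" using insert by blast
      have d: "free_gen K S p \<in> carrier (free_space K S)"
        by (rule free_gen_closed[OF V.R.is_cring p])
      have spc: "s p \<in> carrier K" using sp p by auto
      have "s = (s p \<odot>\<^bsub>free_space K S\<^esub> free_gen K S p) \<oplus>\<^bsub>free_space K S\<^esub> ?u"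
      proof
        fix q show "s q = ((s p \<odot>\<^bsub>free_space K S\<^esub> free_gen K S p) \<oplus>\<^bsub>free_space K S\<^esub> ?u) q"
          using sp p by (cases "q \<in> S") (auto simp: free_space_ops[OF V.R.ring_axioms] free_gen_def PiE_def extensional_def Pi_def)
      qed
      then show "f s = g s"
        using fu eq[OF p] d u spc by (metis f.f_add f.f_smult g.f_add g.f_smult F.smult_closed)
    qed
  qed
  from this[of "{p \<in> S. s p \<noteq> \<zero>\<^bsub>K\<^esub>}"] assms(5) show ?thesis by (auto simp: free_space_carrier)
qed

lemma quot_space_module:
  assumes "module K V" "LinearCombinations.submodule K W V"
  shows quot_module: "module K (quot_space V W)"
    and quot_null: "w \<in> W \<Longrightarrow> W +>\<^bsub>V\<^esub> w = \<zero>\<^bsub>quot_space V W\<^esub>"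
    and quot_proj: "(\<lambda>x. W +>\<^bsub>V\<^esub> x) \<in> module_hom K V (quot_space V W)"
proof -
  interpret V: module K V by fact
  interpret W: LinearCombinations.submodule K W V by fact
  have sg: "subgroup W (add_monoid V)"
  proof (rule V.add.subgroupI)
    show "W \<noteq> {}" using W.zero_closed by blast
    show "\<And>a. a \<in> W \<Longrightarrow> \<ominus>\<^bsub>V\<^esub> a \<in> W"
      using W.smult_closed[of "\<ominus>\<^bsub>K\<^esub> \<one>\<^bsub>K\<^esub>"] W.subset V.smult_minus_1
      by (metis V.R.add.inv_closed V.R.one_closed subsetD)
  qed (use W.subset in auto)
  interpret W: abelian_subgroup W V
    by (rule abelian_subgroupI3[OF additive_subgroup.intro[OF sg] V.abelian_group_axioms])
  have sm: "a \<odot>\<^bsub>quot_space V W\<^esub> (W +>\<^bsub>V\<^esub> x) = W +>\<^bsub>V\<^esub> (a \<odot>\<^bsub>V\<^esub> x)"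
    if a: "a \<in> carrier K" and x: "x \<in> carrier V" for a x
  proof -
    have "W +>\<^bsub>V\<^esub> (a \<odot>\<^bsub>V\<^esub> y) = W +>\<^bsub>V\<^esub> (a \<odot>\<^bsub>V\<^esub> x)" if y: "y \<in> W +>\<^bsub>V\<^esub> x" for y
    proof -
      obtain w where w: "w \<in> W" "y = w \<oplus>\<^bsub>V\<^esub> x"
        using y by (auto simp: a_r_coset_def r_coset_def)
      have wV: "w \<in> carrier V" using w W.subset by auto
      have "a \<odot>\<^bsub>V\<^esub> y = a \<odot>\<^bsub>V\<^esub> w \<oplus>\<^bsub>V\<^esub> a \<odot>\<^bsub>V\<^esub> x"
        using a x wV w by (simp add: V.smult_r_distr)
      moreover have "a \<odot>\<^bsub>V\<^esub> w \<in> W" using a w by simp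
      ultimately have "a \<odot>\<^bsub>V\<^esub> y \<in> W +>\<^bsub>V\<^esub> (a \<odot>\<^bsub>V\<^esub> x)" by (auto simp: a_r_coset_def r_coset_def)
      then show ?thesis
        using V.a_repr_independence'[OF _ _ sg, of _ "a \<odot>\<^bsub>V\<^esub> x", folded a_r_coset_def] a x by simp
    qed
    then have "(\<Union>y\<in>W +>\<^bsub>V\<^esub> x. W +>\<^bsub>V\<^esub> (a \<odot>\<^bsub>V\<^esub> y)) = (\<Union>y\<in>W +>\<^bsub>V\<^esub> x. W +>\<^bsub>V\<^esub> (a \<odot>\<^bsub>V\<^esub> x))"
      by (intro SUP_cong refl)
    moreover have "W +>\<^bsub>V\<^esub> x \<noteq> {}" using W.a_rcos_self[OF x] by blast
    ultimately show ?thesis by (simp add: quot_space_def)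
  qed
  have car: "carrier (quot_space V W) = (\<lambda>x. W +>\<^bsub>V\<^esub> x) ` carrier V"
    by (auto simp: quot_space_def A_RCOSETS_def')
  have ad: "(W +>\<^bsub>V\<^esub> x) \<oplus>\<^bsub>quot_space V W\<^esub> (W +>\<^bsub>V\<^esub> y) = W +>\<^bsub>V\<^esub> (x \<oplus>\<^bsub>V\<^esub> y)"
    if "x \<in> carrier V" "y \<in> carrier V" for x y
    using that by (simp add: quot_space_def W.a_rcos_sum)
  have ze: "\<zero>\<^bsub>quot_space V W\<^esub> = W +>\<^bsub>V\<^esub> \<zero>\<^bsub>V\<^esub>"
    using W.subset by (simp add: quot_space_def V.a_coset_add_zero)
  have ag: "abelian_group (quot_space V W)"
  proof (rule abelian_groupI)
    fix X assume "X \<in> carrier (quot_space V W)"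
    then obtain x where x: "x \<in> carrier V" "X = W +>\<^bsub>V\<^esub> x" by (auto simp: car)
    then have "(W +>\<^bsub>V\<^esub> (\<ominus>\<^bsub>V\<^esub> x)) \<oplus>\<^bsub>quot_space V W\<^esub> X = \<zero>\<^bsub>quot_space V W\<^esub>"
      by (simp add: ad ze V.l_neg)
    with x show "\<exists>Y\<in>carrier (quot_space V W). Y \<oplus>\<^bsub>quot_space V W\<^esub> X = \<zero>\<^bsub>quot_space V W\<^esub>"
      by (auto simp: car)
  qed (auto simp: car ad ze V.M.a_assoc, simp_all add: V.M.a_comm)
  show "module K (quot_space V W)"
    by (rule moduleI[OF V.R.is_cring ag])
      (auto simp: car sm ad V.smult_l_distr V.smult_r_distr V.smult_assoc1)
  show "w \<in> W \<Longrightarrow> W +>\<^bsub>V\<^esub> w = \<zero>\<^bsub>quot_space V W\<^esub>"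
    using V.add.coset_join2[OF _ sg, folded a_r_coset_def] W.subset by (auto simp: quot_space_def)
  show "(\<lambda>x. W +>\<^bsub>V\<^esub> x) \<in> module_hom K V (quot_space V W)"
    by (auto simp: module_hom_def car sm ad)
qed

locale tensor_modules = M: module K M + N: module K N
  for K :: "('k, 'r) ring_scheme" and M :: "('k, 'm, 'u) module_scheme"
    and N :: "('k, 'n, 'v) module_scheme"
begin

lemma pair_module: "module K (pair_space K M N)"
  unfolding pair_space_def by (rule free_space_module) (rule M.R.is_cring)

sublocale F: module K "pair_space K M N" by (rule pair_module)

lemma pair_gen_closed [simp]:
  "\<lbrakk>x \<in> carrier M; y \<in> carrier N\<rbrakk> \<Longrightarrow> pair_gen K M N x y \<in> carrier (pair_space K M N)"
  unfolding pair_space_def pair_gen_def by (rule free_gen_closed) (auto simp: M.R.is_cring)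

lemma tensor_rels_closed: "tensor_rels K M N \<subseteq> carrier (pair_space K M N)"
  unfolding tensor_rels_def by (auto intro!: F.minus_closed)

lemma tensor_null_submodule: "LinearCombinations.submodule K (tensor_null K M N) (pair_space K M N)"
  unfolding tensor_null_def by (rule F.span_is_submodule) (rule tensor_rels_closed)

lemma tensor_module: "module K (M \<boxtimes>\<^bsub>K\<^esub> N)"
  unfolding tensor_def by (rule quot_module[OF pair_module tensor_null_submodule])

sublocale T: module K "M \<boxtimes>\<^bsub>K\<^esub> N" by (rule tensor_module)

abbreviation "proj \<equiv> (\<lambda>x. tensor_null K M N +>\<^bsub>pair_space K M N\<^esub> x)"

lemma proj_hom: "proj \<in> module_hom K (pair_space K M N) (M \<boxtimes>\<^bsub>K\<^esub> N)"
  unfolding tensor_def by (rule quot_proj[OF pair_module tensor_null_submodule])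

sublocale pr: mod_hom K "pair_space K M N" "M \<boxtimes>\<^bsub>K\<^esub> N" proj
  by unfold_locales (rule proj_hom)

lemma tens_closed: "\<lbrakk>x \<in> carrier M; y \<in> carrier N\<rbrakk> \<Longrightarrow> tens K M N x y \<in> carrier (M \<boxtimes>\<^bsub>K\<^esub> N)"
  unfolding tens_def by (intro pr.f_im) simp

lemma rel_proj: "r \<in> tensor_rels K M N \<Longrightarrow> proj r = \<zero>\<^bsub>M \<boxtimes>\<^bsub>K\<^esub> N\<^esub>"
proof -
  assume r: "r \<in> tensor_rels K M N"
  then have "r \<in> tensor_null K M N"
    unfolding tensor_null_def using F.in_own_span[OF tensor_rels_closed] by blast
  then show ?thesis
    unfolding tensor_def by (rule quot_null[OF pair_module tensor_null_submodule])
qed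

lemma rel_eq:
  assumes s: "s \<in> carrier (pair_space K M N)" and t: "t \<in> carrier (pair_space K M N)"
    and r: "s \<ominus>\<^bsub>pair_space K M N\<^esub> t \<in> tensor_rels K M N"
  shows "proj s = proj t"
proof -
  have "proj s \<ominus>\<^bsub>M \<boxtimes>\<^bsub>K\<^esub> N\<^esub> proj t = \<zero>\<^bsub>M \<boxtimes>\<^bsub>K\<^esub> N\<^esub>"
    by (rule trans[OF pr.f_minus[OF s t, symmetric] rel_proj[OF r]])
  with pr.f_im[OF s] pr.f_im[OF t] show ?thesis
    using T.M.minus_equality[of "proj s" "\<ominus>\<^bsub>M \<boxtimes>\<^bsub>K\<^esub> N\<^esub> proj t"] by (simp add: a_minus_def)
qed

lemma tens_bilinear:
  "\<lbrakk>x \<in> carrier M; x' \<in> carrier M; y \<in> carrier N\<rbrakk> \<Longrightarrow>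
    tens K M N (x \<oplus>\<^bsub>M\<^esub> x') y = tens K M N x y \<oplus>\<^bsub>M \<boxtimes>\<^bsub>K\<^esub> N\<^esub> tens K M N x' y"
  "\<lbrakk>x \<in> carrier M; y \<in> carrier N; y' \<in> carrier N\<rbrakk> \<Longrightarrow>
    tens K M N x (y \<oplus>\<^bsub>N\<^esub> y') = tens K M N x y \<oplus>\<^bsub>M \<boxtimes>\<^bsub>K\<^esub> N\<^esub> tens K M N x y'"
  "\<lbrakk>a \<in> carrier K; x \<in> carrier M; y \<in> carrier N\<rbrakk> \<Longrightarrow>
    tens K M N (a \<odot>\<^bsub>M\<^esub> x) y = a \<odot>\<^bsub>M \<boxtimes>\<^bsub>K\<^esub> N\<^esub> tens K M N x y"
  "\<lbrakk>a \<in> carrier K; x \<in> carrier M; y \<in> carrier N\<rbrakk> \<Longrightarrow>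
    tens K M N x (a \<odot>\<^bsub>N\<^esub> y) = a \<odot>\<^bsub>M \<boxtimes>\<^bsub>K\<^esub> N\<^esub> tens K M N x y"
proof -
  let ?P = "pair_space K M N" and ?g = "pair_gen K M N"
  show "tens K M N (x \<oplus>\<^bsub>M\<^esub> x') y = tens K M N x y \<oplus>\<^bsub>M \<boxtimes>\<^bsub>K\<^esub> N\<^esub> tens K M N x' y"
    if h: "x \<in> carrier M" "x' \<in> carrier M" "y \<in> carrier N"
  proof -
    have "proj (?g (x \<oplus>\<^bsub>M\<^esub> x') y) = proj (?g x y \<oplus>\<^bsub>?P\<^esub> ?g x' y)"
      by (rule rel_eq) (use h in \<open>simp_all, unfold tensor_rels_def, blast\<close>)
    with h show ?thesis unfolding tens_def by simp
  qed
  show "tens K M N x (y \<oplus>\<^bsub>N\<^esub> y') = tens K M N x y \<oplus>\<^bsub>M \<boxtimes>\<^bsub>K\<^esub> N\<^esub> tens K M N x y'"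
    if h: "x \<in> carrier M" "y \<in> carrier N" "y' \<in> carrier N"
  proof -
    have "proj (?g x (y \<oplus>\<^bsub>N\<^esub> y')) = proj (?g x y \<oplus>\<^bsub>?P\<^esub> ?g x y')"
      by (rule rel_eq) (use h in \<open>simp_all, unfold tensor_rels_def, blast\<close>)
    with h show ?thesis unfolding tens_def by simp
  qed
  show "tens K M N (a \<odot>\<^bsub>M\<^esub> x) y = a \<odot>\<^bsub>M \<boxtimes>\<^bsub>K\<^esub> N\<^esub> tens K M N x y"
    if h: "a \<in> carrier K" "x \<in> carrier M" "y \<in> carrier N"
  proof -
    have "proj (?g (a \<odot>\<^bsub>M\<^esub> x) y) = proj (a \<odot>\<^bsub>?P\<^esub> ?g x y)"
      by (rule rel_eq) (use h in \<open>simp_all, unfold tensor_rels_def, blast\<close>)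
    with h show ?thesis unfolding tens_def by simp
  qed
  show "tens K M N x (a \<odot>\<^bsub>N\<^esub> y) = a \<odot>\<^bsub>M \<boxtimes>\<^bsub>K\<^esub> N\<^esub> tens K M N x y"
    if h: "a \<in> carrier K" "x \<in> carrier M" "y \<in> carrier N"
  proof -
    have "proj (?g x (a \<odot>\<^bsub>N\<^esub> y)) = proj (a \<odot>\<^bsub>?P\<^esub> ?g x y)"
      by (rule rel_eq) (use h in \<open>simp_all, unfold tensor_rels_def, blast\<close>)
    with h show ?thesis unfolding tens_def by simp
  qed
qed

lemma tensor_hom_eqI:
  assumes "module K V" "f \<in> module_hom K (M \<boxtimes>\<^bsub>K\<^esub> N) V" "g \<in> module_hom K (M \<boxtimes>\<^bsub>K\<^esub> N) V"
    and eq: "\<And>x y. \<lbrakk>x \<in> carrier M; y \<in> carrier N\<rbrakk> \<Longrightarrow> f (tens K M N x y) = g (tens K M N x y)"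
    and t: "t \<in> carrier (M \<boxtimes>\<^bsub>K\<^esub> N)"
  shows "f t = g t"
proof -
  interpret f: mod_hom K "M \<boxtimes>\<^bsub>K\<^esub> N" V f by (intro mod_hom.intro mod_hom_axioms.intro tensor_module assms)
  interpret g: mod_hom K "M \<boxtimes>\<^bsub>K\<^esub> N" V g by (intro mod_hom.intro mod_hom_axioms.intro tensor_module assms)
  have fp: "f \<circ> proj \<in> module_hom K (free_space K (carrier M \<times> carrier N)) V"
    unfolding pair_space_def[symmetric] by (auto simp: module_hom_def)
  have gp: "g \<circ> proj \<in> module_hom K (free_space K (carrier M \<times> carrier N)) V"
    unfolding pair_space_def[symmetric] by (auto simp: module_hom_def)
  obtain s where s: "s \<in> carrier (pair_space K M N)" "t = proj s"
    using t by (auto simp: tensor_def quot_space_def A_RCOSETS_def')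
  have "(f \<circ> proj) s = (g \<circ> proj) s"
  proof (rule free_hom_eqI[OF assms(1) fp gp])
    fix p assume "p \<in> carrier M \<times> carrier N"
    then show "(f \<circ> proj) (free_gen K (carrier M \<times> carrier N) p) =
        (g \<circ> proj) (free_gen K (carrier M \<times> carrier N) p)"
      using eq[of "fst p" "snd p"] unfolding tens_def pair_gen_def comp_def by (cases p) simp
  qed (use s in \<open>unfold pair_space_def, blast\<close>)
  with s show ?thesis by simp
qed

lemma tlift:
  assumes V: "module K V"
    and f: "\<And>x y. \<lbrakk>x \<in> carrier M; y \<in> carrier N\<rbrakk> \<Longrightarrow> f x y \<in> carrier V"
    "\<And>x x' y. \<lbrakk>x \<in> carrier M; x' \<in> carrier M; y \<in> carrier N\<rbrakk> \<Longrightarrow> f (x \<oplus>\<^bsub>M\<^esub> x') y = f x y \<oplus>\<^bsub>V\<^esub> f x' y"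
    "\<And>x y y'. \<lbrakk>x \<in> carrier M; y \<in> carrier N; y' \<in> carrier N\<rbrakk> \<Longrightarrow> f x (y \<oplus>\<^bsub>N\<^esub> y') = f x y \<oplus>\<^bsub>V\<^esub> f x y'"
    "\<And>a x y. \<lbrakk>a \<in> carrier K; x \<in> carrier M; y \<in> carrier N\<rbrakk> \<Longrightarrow> f (a \<odot>\<^bsub>M\<^esub> x) y = a \<odot>\<^bsub>V\<^esub> f x y"
    "\<And>a x y. \<lbrakk>a \<in> carrier K; x \<in> carrier M; y \<in> carrier N\<rbrakk> \<Longrightarrow> f x (a \<odot>\<^bsub>N\<^esub> y) = a \<odot>\<^bsub>V\<^esub> f x y"
  shows tlift_hom: "tlift K M N V f \<in> module_hom K (M \<boxtimes>\<^bsub>K\<^esub> N) V"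
    and tlift_tens: "\<lbrakk>x \<in> carrier M; y \<in> carrier N\<rbrakk> \<Longrightarrow> tlift K M N V f (tens K M N x y) = f x y"
proof -
  interpret V: module K V by fact
  let ?S = "carrier M \<times> carrier N"
  let ?e = "free_eval K ?S V (\<lambda>p. f (fst p) (snd p))"
  have g: "(\<lambda>p. f (fst p) (snd p)) \<in> ?S \<rightarrow> carrier V" using f(1) by auto
  have eh: "?e \<in> module_hom K (pair_space K M N) V"
    unfolding pair_space_def by (rule free_eval_hom[OF V g])
  interpret e: mod_hom K "pair_space K M N" V ?e by unfold_locales (rule eh)
  have eg: "?e (pair_gen K M N x y) = f x y" if "x \<in> carrier M" "y \<in> carrier N" for x y
    unfolding pair_gen_def using free_eval_gen[OF V g, of "(x, y)"] that by simp
  have "tensor_rels K M N \<subseteq> e.ker"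
    unfolding tensor_rels_def e.ker_def
    using f by (auto simp: eg F.minus_closed)
  then have "tensor_null K M N \<subseteq> e.ker"
    unfolding tensor_null_def by (rule F.span_is_subset) (rule e.ker_is_submodule)
  then have n: "?e w = \<zero>\<^bsub>V\<^esub>" if "w \<in> tensor_null K M N" for w
    using that by (auto simp: e.ker_def)
  interpret W: LinearCombinations.submodule K "tensor_null K M N" "pair_space K M N"
    by (rule tensor_null_submodule)
  have l: "tlift K M N V f (proj s) = ?e s" if s: "s \<in> carrier (pair_space K M N)" for s
  proof -
    have "?e z = ?e s" if z: "z \<in> proj s" for z
    proof -
      obtain w where "w \<in> tensor_null K M N" "z = w \<oplus>\<^bsub>pair_space K M N\<^esub> s"
        using z by (auto simp: a_r_coset_def r_coset_def)
      then show ?thesis using n[of w] s W.subset by (auto)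
    qed
    moreover have "s \<in> proj s"
      by (simp add: a_r_coset_def', rule bexI[OF _ W.zero_closed]) (simp add: s)
    ultimately have "?e ` proj s = {?e s}" by blast
    then show ?thesis by (simp add: tlift_def)
  qed
  have car: "carrier (M \<boxtimes>\<^bsub>K\<^esub> N) = proj ` carrier (pair_space K M N)"
    by (auto simp: tensor_def quot_space_def A_RCOSETS_def')
  show "tlift K M N V f \<in> module_hom K (M \<boxtimes>\<^bsub>K\<^esub> N) V"
    unfolding module_hom_def
  proof (intro CollectI conjI allI impI; (elim conjE)?)
    show "tlift K M N V f \<in> carrier (M \<boxtimes>\<^bsub>K\<^esub> N) \<rightarrow> carrier V"
      by (auto simp: car l)
  next
    fix t u assume "t \<in> carrier (M \<boxtimes>\<^bsub>K\<^esub> N)" "u \<in> carrier (M \<boxtimes>\<^bsub>K\<^esub> N)"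
    then obtain r s where rs: "r \<in> carrier (pair_space K M N)" "s \<in> carrier (pair_space K M N)"
      and tu: "t = proj r" "u = proj s" by (auto simp: car)
    have "tlift K M N V f (proj (r \<oplus>\<^bsub>pair_space K M N\<^esub> s)) =
        tlift K M N V f (proj r) \<oplus>\<^bsub>V\<^esub> tlift K M N V f (proj s)"
      using rs by (simp only: l e.f_add F.M.a_closed)
    then show "tlift K M N V f (t \<oplus>\<^bsub>M \<boxtimes>\<^bsub>K\<^esub> N\<^esub> u) = tlift K M N V f t \<oplus>\<^bsub>V\<^esub> tlift K M N V f u"
      using pr.f_add[OF rs] by (simp only: tu)
  next
    fix a t assume a: "a \<in> carrier K" and "t \<in> carrier (M \<boxtimes>\<^bsub>K\<^esub> N)"
    then obtain s where s: "s \<in> carrier (pair_space K M N)" and t: "t = proj s" by (auto simp: car)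
    have "tlift K M N V f (proj (a \<odot>\<^bsub>pair_space K M N\<^esub> s)) = a \<odot>\<^bsub>V\<^esub> tlift K M N V f (proj s)"
      using a s by (simp only: l e.f_smult F.smult_closed)
    then show "tlift K M N V f (a \<odot>\<^bsub>M \<boxtimes>\<^bsub>K\<^esub> N\<^esub> t) = a \<odot>\<^bsub>V\<^esub> tlift K M N V f t"
      using pr.f_smult[OF a s] by (simp only: t)
  qed
  show "\<lbrakk>x \<in> carrier M; y \<in> carrier N\<rbrakk> \<Longrightarrow> tlift K M N V f (tens K M N x y) = f x y"
    by (simp add: tens_def l eg)
qed

end


subsection \<open>Maps between tensor products\<close>

definition tmap ::
  "('k, 'r) ring_scheme \<Rightarrow> ('k, 'm, 'u) module_scheme \<Rightarrow> ('k, 'n, 'v) module_scheme \<Rightarrow>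
   ('k, 'm1, 'u1) module_scheme \<Rightarrow> ('k, 'n1, 'v1) module_scheme \<Rightarrow>
   ('m \<Rightarrow> 'm1) \<Rightarrow> ('n \<Rightarrow> 'n1) \<Rightarrow> ('m \<times> 'n \<Rightarrow> 'k) set \<Rightarrow> ('m1 \<times> 'n1 \<Rightarrow> 'k) set"
  where "tmap K M N M' N' f g =
    tlift K M N (M' \<boxtimes>\<^bsub>K\<^esub> N') (\<lambda>x y. tens K M' N' (f x) (g y))"

text \<open>The associativity isomorphisms, which are left implicit on paper.\<close>

definition tassoc ::
  "('k, 'r) ring_scheme \<Rightarrow> ('k, 'm, 'u) module_scheme \<Rightarrow> ('k, 'n, 'v) module_scheme \<Rightarrow>
   ('k, 'p, 'w) module_scheme \<Rightarrow>
   ('m \<times> ('n \<times> 'p \<Rightarrow> 'k) set \<Rightarrow> 'k) set \<Rightarrow> (('m \<times> 'n \<Rightarrow> 'k) set \<times> 'p \<Rightarrow> 'k) set"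
  where "tassoc K M N P =
    tlift K M (N \<boxtimes>\<^bsub>K\<^esub> P) ((M \<boxtimes>\<^bsub>K\<^esub> N) \<boxtimes>\<^bsub>K\<^esub> P)
      (\<lambda>x. tlift K N P ((M \<boxtimes>\<^bsub>K\<^esub> N) \<boxtimes>\<^bsub>K\<^esub> P)
        (\<lambda>y z. tens K (M \<boxtimes>\<^bsub>K\<^esub> N) P (tens K M N x y) z))"

definition tassoc' ::
  "('k, 'r) ring_scheme \<Rightarrow> ('k, 'm, 'u) module_scheme \<Rightarrow> ('k, 'n, 'v) module_scheme \<Rightarrow>
   ('k, 'p, 'w) module_scheme \<Rightarrow>
   (('m \<times> 'n \<Rightarrow> 'k) set \<times> 'p \<Rightarrow> 'k) set \<Rightarrow> ('m \<times> ('n \<times> 'p \<Rightarrow> 'k) set \<Rightarrow> 'k) set"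
  where "tassoc' K M N P =
    tlift K (M \<boxtimes>\<^bsub>K\<^esub> N) P (M \<boxtimes>\<^bsub>K\<^esub> N \<boxtimes>\<^bsub>K\<^esub> P)
      (\<lambda>t z. tlift K M N (M \<boxtimes>\<^bsub>K\<^esub> N \<boxtimes>\<^bsub>K\<^esub> P)
        (\<lambda>x y. tens K M (N \<boxtimes>\<^bsub>K\<^esub> P) x (tens K N P y z)) t)"

text \<open>\<open>f \<otimes> id\<close>, for \<open>f\<close> a linear map from \<open>A \<otimes> B\<close> to \<open>A' \<otimes> B'\<close>, as a map between the
  right-nested triple products \<open>A \<otimes> (B \<otimes> C)\<close> and \<open>A' \<otimes> (B' \<otimes> C)\<close>.\<close>

definition tmap_left ::
  "('k, 'r) ring_scheme \<Rightarrow> ('k, 'a, 'ua) module_scheme \<Rightarrow> ('k, 'b, 'ub) module_scheme \<Rightarrow>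
   ('k, 'a1, 'ua1) module_scheme \<Rightarrow> ('k, 'b1, 'ub1) module_scheme \<Rightarrow> ('k, 'c, 'uc) module_scheme \<Rightarrow>
   (('a \<times> 'b \<Rightarrow> 'k) set \<Rightarrow> ('a1 \<times> 'b1 \<Rightarrow> 'k) set) \<Rightarrow>
   ('a \<times> ('b \<times> 'c \<Rightarrow> 'k) set \<Rightarrow> 'k) set \<Rightarrow> ('a1 \<times> ('b1 \<times> 'c \<Rightarrow> 'k) set \<Rightarrow> 'k) set"
  where "tmap_left K A B A' B' C f =
    tassoc' K A' B' C \<circ> tmap K (A \<boxtimes>\<^bsub>K\<^esub> B) C (A' \<boxtimes>\<^bsub>K\<^esub> B') C f id \<circ> tassoc K A B C"


section \<open>Hom-bialgebras\<close>

record ('k, 'm) hom_space = "('k, 'm) module" +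
  twist :: "'m \<Rightarrow> 'm"

record ('k, 'h) hom_bialg = "('k, 'h) hom_space" +
  hmul :: "('h \<times> 'h \<Rightarrow> 'k) set \<Rightarrow> 'h"
  hcomul :: "'h \<Rightarrow> ('h \<times> 'h \<Rightarrow> 'k) set"

abbreviation hprod :: "('k, 'r) ring_scheme \<Rightarrow> ('k, 'h, 'u) hom_bialg_scheme \<Rightarrow> 'h \<Rightarrow> 'h \<Rightarrow> 'h"
  where "hprod K H h h' \<equiv> hmul H (tens K H H h h')"

locale hom_bialgebra = vectorspace K H
  for K :: "('k, 'r) ring_scheme" (structure) and H :: "('k, 'h, 'u) hom_bialg_scheme" +
  assumes twist_hom: "twist H \<in> module_hom K H H"
    and hmul_hom: "hmul H \<in> module_hom K (H \<boxtimes> H) H"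
    and hcomul_hom: "hcomul H \<in> module_hom K H (H \<boxtimes> H)"
    and twist_mul: "\<lbrakk>h \<in> carrier H; h' \<in> carrier H\<rbrakk> \<Longrightarrow>
      twist H (hprod K H h h') = hprod K H (twist H h) (twist H h')"
    and hom_assoc: "\<lbrakk>h \<in> carrier H; h' \<in> carrier H; h'' \<in> carrier H\<rbrakk> \<Longrightarrow>
      hprod K H (twist H h) (hprod K H h' h'') = hprod K H (hprod K H h h') (twist H h'')"
    and hom_coassoc: "h \<in> carrier H \<Longrightarrow>
      tmap K H H (H \<boxtimes> H) H (hcomul H) (twist H) (hcomul H h) =
      tassoc K H H H (tmap K H H H (H \<boxtimes> H) (twist H) (hcomul H) (hcomul H h))"
    and comul_mul: "\<lbrakk>h \<in> carrier H; h' \<in> carrier H\<rbrakk> \<Longrightarrow>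
      hcomul H (hprod K H h h') =
      tlift K H H (H \<boxtimes> H) (\<lambda>h1 h2.
        tlift K H H (H \<boxtimes> H) (\<lambda>h1' h2'.
          tens K H H (hprod K H h1 h1') (hprod K H h2 h2')) (hcomul H h')) (hcomul H h)"
    and comul_twist: "h \<in> carrier H \<Longrightarrow>
      hcomul H (twist H h) = tmap K H H H H (twist H) (twist H) (hcomul H h)"


section \<open>Yetter-Drinfeld modules\<close>

record ('k, 'h, 'm) yd_space = "('k, 'm) hom_space" +
  action :: "('h \<times> 'm \<Rightarrow> 'k) set \<Rightarrow> 'm"
  coaction :: "'m \<Rightarrow> ('h \<times> 'm \<Rightarrow> 'k) set"

abbreviation act ::
  "('k, 'r) ring_scheme \<Rightarrow> ('k, 'h, 'u) hom_bialg_scheme \<Rightarrow> ('k, 'h, 'm, 'v) yd_space_scheme \<Rightarrow>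
   'h \<Rightarrow> 'm \<Rightarrow> 'm"
  where "act K H M h m \<equiv> action M (tens K H M h m)"

locale left_hom_module = hom_bialgebra K H + M: vectorspace K M
  for K :: "('k, 'r) ring_scheme" (structure) and H :: "('k, 'h, 'u) hom_bialg_scheme"
    and M :: "('k, 'h, 'm, 'v) yd_space_scheme" +
  assumes mtwist_hom: "twist M \<in> module_hom K M M"
    and action_hom: "action M \<in> module_hom K (H \<boxtimes> M) M"
    and twist_act: "\<lbrakk>h \<in> carrier H; m \<in> carrier M\<rbrakk> \<Longrightarrow>
      twist M (act K H M h m) = act K H M (twist H h) (twist M m)"
    and act_act: "\<lbrakk>h \<in> carrier H; h' \<in> carrier H; m \<in> carrier M\<rbrakk> \<Longrightarrow>
      act K H M (twist H h) (act K H M h' m) = act K H M (hprod K H h h') (twist M m)"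

locale left_hom_comodule = hom_bialgebra K H + M: vectorspace K M
  for K :: "('k, 'r) ring_scheme" (structure) and H :: "('k, 'h, 'u) hom_bialg_scheme"
    and M :: "('k, 'h, 'm, 'v) yd_space_scheme" +
  assumes mtwist_hom: "twist M \<in> module_hom K M M"
    and coaction_hom: "coaction M \<in> module_hom K M (H \<boxtimes> M)"
    and coaction_twist: "m \<in> carrier M \<Longrightarrow>
      tmap K H M H M (twist H) (twist M) (coaction M m) = coaction M (twist M m)"
    and coaction_coaction: "m \<in> carrier M \<Longrightarrow>
      tmap K H M (H \<boxtimes> H) M (hcomul H) (twist M) (coaction M m) =
      tassoc K H H M (tmap K H M H (H \<boxtimes> M) (twist H) (coaction M) (coaction M m))"

locale yetter_drinfeld = left_hom_module K H M + left_hom_comodule K H M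
  for K :: "('k, 'r) ring_scheme" (structure) and H :: "('k, 'h, 'u) hom_bialg_scheme"
    and M :: "('k, 'h, 'm, 'v) yd_space_scheme" +
  assumes yd_compat: "\<lbrakk>h \<in> carrier H; m \<in> carrier M\<rbrakk> \<Longrightarrow>
      tlift K H H (H \<boxtimes> M) (\<lambda>h1 h2.
        tlift K H M (H \<boxtimes> M) (\<lambda>x m0.
          tens K H M (hprod K H x (twist H (twist H h2))) m0)
          (coaction M (act K H M h1 m))) (hcomul H h) =
      tlift K H H (H \<boxtimes> M) (\<lambda>h1 h2.
        tlift K H M (H \<boxtimes> M) (\<lambda>x m0.
          tens K H M (hprod K H (twist H (twist H h1)) (twist H x)) (act K H M (twist H h2) m0))
          (coaction M m)) (hcomul H h)"

locale yd_object = yetter_drinfeld K H M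
  for K :: "('k, 'r) ring_scheme" (structure) and H :: "('k, 'h, 'u) hom_bialg_scheme"
    and M :: "('k, 'h, 'm, 'v) yd_space_scheme" +
  assumes mtwist_bij: "bij_betw (twist M) (carrier M) (carrier M)"

abbreviation untwist :: "('k, 'm, 'u) hom_space_scheme \<Rightarrow> 'm \<Rightarrow> 'm"
  where "untwist M \<equiv> inv_into (carrier M) (twist M)"

definition braiding ::
  "('k, 'r) ring_scheme \<Rightarrow> ('k, 'h, 'u) hom_bialg_scheme \<Rightarrow>
   ('k, 'h, 'm, 'v) yd_space_scheme \<Rightarrow> ('k, 'h, 'n, 'w) yd_space_scheme \<Rightarrow>
   ('m \<times> 'n \<Rightarrow> 'k) set \<Rightarrow> ('n \<times> 'm \<Rightarrow> 'k) set"
  where "braiding K H M N =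
    tlift K M N (N \<boxtimes>\<^bsub>K\<^esub> M) (\<lambda>m n.
      tlift K H M (N \<boxtimes>\<^bsub>K\<^esub> M) (\<lambda>x m0.
        tens K N M (untwist N (act K H N (untwist H x) n)) (untwist M m0)) (coaction M m))"

end

theory Submission
  imports Defs
begin

text \<open>
  For fixed \<open>m\<close>, \<open>n\<close>, \<open>p\<close>, the compatibility of the structure maps with the twists and the
  coassociativity of the coaction on \<open>M\<close> bring both sides of the braid relation,
  evaluated at \<open>m \<otimes> n \<otimes> p\<close>, into the form
  \<open>F(h\<^sub>1 \<otimes> h\<^sub>2) \<otimes> \<alpha>\<^sub>M\<^sup>-\<^sup>1(m\<^sub>0)\<close> with \<open>h = m\<^sub>-\<^sub>1\<close> and \<open>F\<close> linear from \<open>H \<otimes> H\<close> to \<open>P \<otimes> N\<close>.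
  Writing \<open>h = \<alpha>\<^sub>H\<^sup>2(g)\<close>, the two values \<open>F(h\<^sub>1 \<otimes> h\<^sub>2)\<close> are the images of the two sides of the
  Yetter-Drinfeld condition for \<open>g\<close> and \<open>n\<close> under
  \<open>x \<otimes> y \<mapsto> \<alpha>\<^sub>P\<^sup>-\<^sup>1(\<alpha>\<^sub>H\<^sup>-\<^sup>3(x) \<cdot> p) \<otimes> \<alpha>\<^sub>N\<^sup>-\<^sup>2(y)\<close>.
\<close>

section \<open>Linear maps on tensor products\<close>

lemma hom_closed: "\<lbrakk>f \<in> module_hom K A B; x \<in> carrier A\<rbrakk> \<Longrightarrow> f x \<in> carrier B"
  by (auto simp: module_hom_def)

lemma hom_id: "(\<lambda>x. x) \<in> module_hom K A A"
  by (auto simp: module_hom_def)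

lemma hom_compose:
  "\<lbrakk>g \<in> module_hom K A B; f \<in> module_hom K Z A\<rbrakk> \<Longrightarrow> (\<lambda>x. g (f x)) \<in> module_hom K Z B"
  by (auto simp: module_hom_def Pi_def)

lemma hom_comp:
  "\<lbrakk>g \<in> module_hom K A B; f \<in> module_hom K Z A\<rbrakk> \<Longrightarrow> g \<circ> f \<in> module_hom K Z B"
  unfolding comp_def by (rule hom_compose)

lemma hom_sum:
  assumes "module K A" "module K B" "f \<in> module_hom K A B" "g \<in> module_hom K A B"
  shows "(\<lambda>x. f x \<oplus>\<^bsub>B\<^esub> g x) \<in> module_hom K A B"
proof -
  interpret A: module K A by fact
  interpret B: module K B by fact
  show ?thesis using assms(3,4)
    by (auto simp: module_hom_def Pi_def B.smult_r_distr B.M.add.m_ac)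
qed

lemma hom_scale:
  assumes "module K A" "module K B" "f \<in> module_hom K A B" "a \<in> carrier K"
  shows "(\<lambda>x. a \<odot>\<^bsub>B\<^esub> f x) \<in> module_hom K A B"
proof -
  interpret A: module K A by fact
  interpret B: module K B by fact
  show ?thesis using assms(3,4)
    by (auto simp: module_hom_def Pi_def B.smult_r_distr A.R.m_comm simp flip: B.smult_assoc1)
qed

lemma inv_into_hom:
  assumes "module K A" "f \<in> module_hom K A A" "bij_betw f (carrier A) (carrier A)"
  shows "inv_into (carrier A) f \<in> module_hom K A A"
proof -
  interpret A: module K A by fact
  let ?g = "inv_into (carrier A) f"
  have g: "?g x \<in> carrier A" "f (?g x) = x" if "x \<in> carrier A" for x
    using that assms(3) by (auto simp: bij_betw_def inv_into_into f_inv_into_f)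
  have eq: "?g y = x" if "x \<in> carrier A" "f x = y" for x y
    using that assms(3) by (auto simp: bij_betw_def)
  show ?thesis using g assms(2) unfolding module_hom_def
    by (auto simp: Pi_def intro!: eq)
qed

text \<open>Bilinearity is phrased through \<open>module_hom\<close> in each argument separately, so
  that the same introduction rules that prove linearity of composite maps also prove
  bilinearity.\<close>

definition bilinear_map ::
  "('k, 'r) ring_scheme \<Rightarrow> ('k, 'm, 'u) module_scheme \<Rightarrow> ('k, 'n, 'v) module_scheme \<Rightarrow>
   ('k, 'a, 'w) module_scheme \<Rightarrow> ('m \<Rightarrow> 'n \<Rightarrow> 'a) \<Rightarrow> bool"
  where "bilinear_map K M N V f \<longleftrightarrow>
    (\<forall>x\<in>carrier M. (\<lambda>y. f x y) \<in> module_hom K N V) \<and>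
    (\<forall>y\<in>carrier N. (\<lambda>x. f x y) \<in> module_hom K M V)"

lemma bilinear_mapI:
  assumes "\<And>x. x \<in> carrier M \<Longrightarrow> (\<lambda>y. f x y) \<in> module_hom K N V"
    and "\<And>y. y \<in> carrier N \<Longrightarrow> (\<lambda>x. f x y) \<in> module_hom K M V"
  shows "bilinear_map K M N V f"
  using assms by (auto simp: bilinear_map_def)

section \<open>Maps out of a tensor product and their dependence on parameters\<close>

lemma tensor_modules_module: "\<lbrakk>module K M; module K N\<rbrakk> \<Longrightarrow> module K (M \<boxtimes>\<^bsub>K\<^esub> N)"
  by (rule tensor_modules.tensor_module) (rule tensor_modules.intro)

context
  fixes K :: "('k, 'r) ring_scheme" (structure)
    and M :: "('k, 'm, 'u) module_scheme" and N :: "('k, 'n, 'v) module_scheme"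
  assumes M: "module K M" and N: "module K N"
begin

interpretation tensor_modules K M N by (intro tensor_modules.intro M N)

text \<open>The membership of \<open>t\<close> comes before the two maps, so that a call can fix
  \<open>t\<close> first and read both sides of the goal as linear maps evaluated at
  \<open>t\<close>.\<close>

lemma tensor_eqI:
  assumes "t \<in> carrier (M \<boxtimes> N)" "module K V"
    "f \<in> module_hom K (M \<boxtimes> N) V" "g \<in> module_hom K (M \<boxtimes> N) V"
    "\<And>x y. \<lbrakk>x \<in> carrier M; y \<in> carrier N\<rbrakk> \<Longrightarrow> f (tens K M N x y) = g (tens K M N x y)"
  shows "f t = g t"
  by (rule tensor_hom_eqI[OF assms(2-5,1)])

lemma tens_carrier: "\<lbrakk>x \<in> carrier M; y \<in> carrier N\<rbrakk> \<Longrightarrow> tens K M N x y \<in> carrier (M \<boxtimes> N)"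
  by (rule tens_closed)

lemma tens_hom_left:
  "\<lbrakk>f \<in> module_hom K Z M; y \<in> carrier N\<rbrakk> \<Longrightarrow> (\<lambda>x. tens K M N (f x) y) \<in> module_hom K Z (M \<boxtimes> N)"
  by (auto simp: module_hom_def Pi_def tens_closed tens_bilinear)

lemma tens_hom_right:
  "\<lbrakk>x \<in> carrier M; f \<in> module_hom K Z N\<rbrakk> \<Longrightarrow> (\<lambda>y. tens K M N x (f y)) \<in> module_hom K Z (M \<boxtimes> N)"
  by (auto simp: module_hom_def Pi_def tens_closed tens_bilinear)

context
  fixes V :: "('k, 'a, 'w) module_scheme"
  assumes V: "module K V"
begin

lemma
  assumes "bilinear_map K M N V f"
  shows tlift_module_hom: "tlift K M N V f \<in> module_hom K (M \<boxtimes> N) V"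
    and tlift_tens_eq: "\<lbrakk>x \<in> carrier M; y \<in> carrier N\<rbrakk> \<Longrightarrow> tlift K M N V f (tens K M N x y) = f x y"
proof -
  from assms have f: "\<And>x. x \<in> carrier M \<Longrightarrow> f x \<in> module_hom K N V"
    "\<And>y. y \<in> carrier N \<Longrightarrow> (\<lambda>x. f x y) \<in> module_hom K M V"
    by (auto simp: bilinear_map_def)
  note f_rules = hom_closed[OF f(1)] module_hom_add[OF f(1)] module_hom_add[OF f(2)]
    module_hom_smult[OF f(1)] module_hom_smult[OF f(2)]
  show "tlift K M N V f \<in> module_hom K (M \<boxtimes> N) V"
    by (rule tlift_hom[OF V]) (simp_all add: f_rules)
  show "\<lbrakk>x \<in> carrier M; y \<in> carrier N\<rbrakk> \<Longrightarrow> tlift K M N V f (tens K M N x y) = f x y"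
    by (rule tlift_tens[OF V]) (simp_all add: f_rules)
qed

text \<open>For fixed parameters, both sides of additivity and of homogeneity in \<open>z\<close>
  are linear in \<open>t\<close>. So only pure tensors need checking, where the claim is the last
  hypothesis. Nested lifts need this: there the inner lift has to be linear in a variable of the
  outer one.\<close>

lemma tlift_parameter_hom:
  assumes Z: "module K Z" and t: "t \<in> carrier (M \<boxtimes> N)"
    and f: "\<And>z. z \<in> carrier Z \<Longrightarrow> bilinear_map K M N V (f z)"
    and z: "\<And>x y. \<lbrakk>x \<in> carrier M; y \<in> carrier N\<rbrakk> \<Longrightarrow> (\<lambda>z. f z x y) \<in> module_hom K Z V"
  shows "(\<lambda>z. tlift K M N V (f z) t) \<in> module_hom K Z V"
proof -
  interpret Z: module K Z by fact
  have l: "tlift K M N V (f z) \<in> module_hom K (M \<boxtimes> N) V" if "z \<in> carrier Z" for z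
    using that by (intro tlift_module_hom f)
  have e: "tlift K M N V (f z) (tens K M N x y) = f z x y"
    if "z \<in> carrier Z" "x \<in> carrier M" "y \<in> carrier N" for x y z
    using that by (intro tlift_tens_eq f)
  have "tlift K M N V (f (z \<oplus>\<^bsub>Z\<^esub> z')) t = tlift K M N V (f z) t \<oplus>\<^bsub>V\<^esub> tlift K M N V (f z') t"
    if h: "z \<in> carrier Z" "z' \<in> carrier Z" for z z'
    by (rule tensor_eqI[OF t V l hom_sum[OF tensor_module V l l]])
      (use h module_hom_add[OF z] in \<open>simp_all add: e\<close>)
  moreover have "tlift K M N V (f (a \<odot>\<^bsub>Z\<^esub> z)) t = a \<odot>\<^bsub>V\<^esub> tlift K M N V (f z) t"
    if h: "a \<in> carrier K" "z \<in> carrier Z" for a z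
    by (rule tensor_eqI[OF t V l hom_scale[OF tensor_module V l]])
      (use h module_hom_smult[OF z] in \<open>simp_all add: e\<close>)
  ultimately show ?thesis
    using hom_closed[OF l t] by (auto simp: module_hom_def)
qed

end

section \<open>Tensor products of linear maps\<close>

context
  fixes M' :: "('k, 'm1, 'u1) module_scheme" and N' :: "('k, 'n1, 'v1) module_scheme"
  assumes M': "module K M'" and N': "module K N'"
begin

interpretation T': tensor_modules K M' N' by (intro tensor_modules.intro M' N')

lemma tmap_bilinear:
  assumes f: "f \<in> module_hom K M M'" and g: "g \<in> module_hom K N N'"
  shows "bilinear_map K M N (M' \<boxtimes> N') (\<lambda>x y. tens K M' N' (f x) (g y))"
  using assms
  by (auto simp: bilinear_map_def module_hom_def Pi_def T'.tens_closed T'.tens_bilinear)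

lemma tmap_module_hom:
  "\<lbrakk>f \<in> module_hom K M M'; g \<in> module_hom K N N'\<rbrakk> \<Longrightarrow>
    tmap K M N M' N' f g \<in> module_hom K (M \<boxtimes> N) (M' \<boxtimes> N')"
  unfolding tmap_def by (intro tlift_module_hom T'.tensor_module tmap_bilinear)

lemma tmap_tens:
  "\<lbrakk>x \<in> carrier M; y \<in> carrier N; f \<in> module_hom K M M'; g \<in> module_hom K N N'\<rbrakk> \<Longrightarrow>
    tmap K M N M' N' f g (tens K M N x y) = tens K M' N' (f x) (g y)"
  unfolding tmap_def by (intro tlift_tens_eq T'.tensor_module tmap_bilinear)

lemma tmap_parameter_left:
  assumes "module K Z" "t \<in> carrier (M \<boxtimes> N)" "g \<in> module_hom K N N'"
    and "\<And>z. z \<in> carrier Z \<Longrightarrow> f z \<in> module_hom K M M'"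
    and "\<And>x. x \<in> carrier M \<Longrightarrow> (\<lambda>z. f z x) \<in> module_hom K Z M'"
  shows "(\<lambda>z. tmap K M N M' N' (f z) g t) \<in> module_hom K Z (M' \<boxtimes> N')"
  unfolding tmap_def using assms
  by (intro tlift_parameter_hom T'.tensor_module tmap_bilinear)
    (auto simp: module_hom_def Pi_def T'.tens_closed T'.tens_bilinear)

lemma tmap_parameter_right:
  assumes "module K Z" "t \<in> carrier (M \<boxtimes> N)" "f \<in> module_hom K M M'"
    and "\<And>z. z \<in> carrier Z \<Longrightarrow> g z \<in> module_hom K N N'"
    and "\<And>y. y \<in> carrier N \<Longrightarrow> (\<lambda>z. g z y) \<in> module_hom K Z N'"
  shows "(\<lambda>z. tmap K M N M' N' f (g z) t) \<in> module_hom K Z (M' \<boxtimes> N')"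
  unfolding tmap_def using assms
  by (intro tlift_parameter_hom T'.tensor_module tmap_bilinear)
    (auto simp: module_hom_def Pi_def T'.tens_closed T'.tens_bilinear)

end

end

section \<open>The associativity isomorphisms\<close>

context
  fixes K :: "('k, 'r) ring_scheme" (structure)
    and A :: "('k, 'a, 'ua) module_scheme" and B :: "('k, 'b, 'ub) module_scheme"
    and C :: "('k, 'c, 'uc) module_scheme"
  assumes A: "module K A" and B: "module K B" and C: "module K C"
begin

lemma tassoc_bilinear:
  "x \<in> carrier A \<Longrightarrow> bilinear_map K B C ((A \<boxtimes> B) \<boxtimes> C) (\<lambda>y z. tens K (A \<boxtimes> B) C (tens K A B x y) z)"
  by (intro bilinear_mapI tens_hom_left tens_hom_right hom_id tens_carrier A B C tensor_modules_module)

lemma tassoc_bilinear2: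
  "bilinear_map K A (B \<boxtimes> C) ((A \<boxtimes> B) \<boxtimes> C)
    (\<lambda>x. tlift K B C ((A \<boxtimes> B) \<boxtimes> C) (\<lambda>y z. tens K (A \<boxtimes> B) C (tens K A B x y) z))"
  by (rule bilinear_mapI)
    (intro tlift_module_hom tlift_parameter_hom tassoc_bilinear
      tens_hom_left tens_hom_right hom_id tens_carrier A B C tensor_modules_module; assumption)+

lemma tassoc_module_hom:
  "tassoc K A B C \<in> module_hom K (A \<boxtimes> B \<boxtimes> C) ((A \<boxtimes> B) \<boxtimes> C)"
  unfolding tassoc_def by (intro tlift_module_hom tassoc_bilinear2 A B C tensor_modules_module)

lemma tassoc_tens:
  "\<lbrakk>x \<in> carrier A; y \<in> carrier B; z \<in> carrier C\<rbrakk> \<Longrightarrow>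
    tassoc K A B C (tens K A (B \<boxtimes> C) x (tens K B C y z)) = tens K (A \<boxtimes> B) C (tens K A B x y) z"
  unfolding tassoc_def
  by (simp add: tlift_tens_eq tassoc_bilinear tassoc_bilinear2 tens_carrier A B C tensor_modules_module)

lemma tassoc'_bilinear:
  "z \<in> carrier C \<Longrightarrow> bilinear_map K A B (A \<boxtimes> B \<boxtimes> C) (\<lambda>x y. tens K A (B \<boxtimes> C) x (tens K B C y z))"
  by (intro bilinear_mapI tens_hom_left tens_hom_right hom_id tens_carrier A B C tensor_modules_module)

lemma tassoc'_bilinear2:
  "bilinear_map K (A \<boxtimes> B) C (A \<boxtimes> B \<boxtimes> C)
    (\<lambda>t z. tlift K A B (A \<boxtimes> B \<boxtimes> C) (\<lambda>x y. tens K A (B \<boxtimes> C) x (tens K B C y z)) t)"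
  by (rule bilinear_mapI)
    (intro tlift_module_hom tlift_parameter_hom tassoc'_bilinear
      tens_hom_left tens_hom_right hom_id tens_carrier A B C tensor_modules_module; assumption)+

lemma tassoc'_module_hom:
  "tassoc' K A B C \<in> module_hom K ((A \<boxtimes> B) \<boxtimes> C) (A \<boxtimes> B \<boxtimes> C)"
  unfolding tassoc'_def by (intro tlift_module_hom tassoc'_bilinear2 A B C tensor_modules_module)

lemma tassoc'_tens:
  "\<lbrakk>x \<in> carrier A; y \<in> carrier B; z \<in> carrier C\<rbrakk> \<Longrightarrow>
    tassoc' K A B C (tens K (A \<boxtimes> B) C (tens K A B x y) z) = tens K A (B \<boxtimes> C) x (tens K B C y z)"
  unfolding tassoc'_def
  by (simp add: tlift_tens_eq tassoc'_bilinear tassoc'_bilinear2 tens_carrier A B C tensor_modules_module)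

context
  fixes A' :: "('k, 'a1, 'ua1) module_scheme" and B' :: "('k, 'b1, 'ub1) module_scheme"
    and f
  assumes A': "module K A'" and B': "module K B'"
    and f: "f \<in> module_hom K (A \<boxtimes> B) (A' \<boxtimes> B')"
begin

text \<open>\<open>tassoc'\<close> stays in the value because \<open>f\<close> of a pure tensor is
  in general not pure. It disappears only after that value has itself been reduced to pure
  tensors.\<close>

lemma tmap_left_tens:
  "\<lbrakk>x \<in> carrier A; y \<in> carrier B; z \<in> carrier C\<rbrakk> \<Longrightarrow>
    tmap_left K A B A' B' C f (tens K A (B \<boxtimes> C) x (tens K B C y z)) =
    tassoc' K A' B' C (tens K (A' \<boxtimes> B') C (f (tens K A B x y)) z)"
  unfolding tmap_left_def id_def comp_def
  by (simp add: tassoc_tens tmap_tens tens_carrier A B C tensor_modules_module A' B' f hom_id)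

end

end

lemma tmap_left_module_hom:
  assumes "module K A" "module K B" "module K C" "module K A'" "module K B'"
    and "f \<in> module_hom K (A \<boxtimes>\<^bsub>K\<^esub> B) (A' \<boxtimes>\<^bsub>K\<^esub> B')"
  shows "tmap_left K A B A' B' C f \<in> module_hom K (A \<boxtimes>\<^bsub>K\<^esub> B \<boxtimes>\<^bsub>K\<^esub> C) (A' \<boxtimes>\<^bsub>K\<^esub> B' \<boxtimes>\<^bsub>K\<^esub> C)"
  unfolding tmap_left_def id_def
  by (rule hom_comp[OF hom_comp[OF tassoc'_module_hom tmap_module_hom] tassoc_module_hom])
    (intro hom_id tensor_modules_module assms)+

section \<open>Yetter-Drinfeld modules with bijective twists\<close>

text \<open>Write \<open>h \<rhd> m\<close> for this value. It is the combination of action and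
  inverse twists found in \<open>braiding\<close>, which thus sends \<open>m \<otimes> n\<close> to
  \<open>m\<^sub>-\<^sub>1 \<rhd> n \<otimes>
  \<alpha>\<^sub>M\<^sup>-\<^sup>1(m\<^sub>0)\<close>.\<close>

definition twisted_act ::
  "('k, 'r) ring_scheme \<Rightarrow> ('k, 'h, 'u) hom_bialg_scheme \<Rightarrow> ('k, 'h, 'm, 'v) yd_space_scheme \<Rightarrow>
   'h \<Rightarrow> 'm \<Rightarrow> 'm"
  where "twisted_act K H M h m = untwist M (act K H M (untwist H h) m)"

locale yd_bij = yd_object K H M
  for K :: "('k, 'r) ring_scheme" (structure) and H :: "('k, 'h, 'u) hom_bialg_scheme"
    and M :: "('k, 'h, 'm, 'v) yd_space_scheme" +
  assumes twist_bij: "bij_betw (twist H) (carrier H) (carrier H)"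
begin

lemmas module_rules = module_axioms M.module_axioms tensor_modules_module

lemmas untwist_hom = inv_into_hom[OF module_axioms twist_hom twist_bij]
  inv_into_hom[OF M.module_axioms mtwist_hom mtwist_bij]

lemmas structure_homs = twist_hom mtwist_hom untwist_hom hmul_hom hcomul_hom action_hom coaction_hom

lemmas closed_rules = structure_homs[THEN hom_closed] tens_carrier hom_closed[OF tmap_module_hom]
  hom_closed[OF tassoc_module_hom] hom_closed[OF tassoc'_module_hom]

lemmas structure_hom_rules = structure_homs[THEN hom_compose] hom_id

lemmas hom_rules = structure_hom_rules tens_hom_left tens_hom_right tmap_module_hom
  tmap_module_hom[THEN hom_compose, rotated -1] tassoc_module_hom[THEN hom_compose, rotated -1]
  tassoc'_module_hom[THEN hom_compose, rotated -1]

section \<open>Inverse twists against product, action and coaction\<close>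

lemma untwist_simps [simp]:
  "h \<in> carrier H \<Longrightarrow> twist H (untwist H h) = h"
  "h \<in> carrier H \<Longrightarrow> untwist H (twist H h) = h"
  "m \<in> carrier M \<Longrightarrow> twist M (untwist M m) = m"
  "m \<in> carrier M \<Longrightarrow> untwist M (twist M m) = m"
  using twist_bij mtwist_bij by (auto simp: bij_betw_def f_inv_into_f)

lemma twist_closed [simp]:
  "h \<in> carrier H \<Longrightarrow> twist H h \<in> carrier H"
  "h \<in> carrier H \<Longrightarrow> untwist H h \<in> carrier H"
  "m \<in> carrier M \<Longrightarrow> twist M m \<in> carrier M"
  "m \<in> carrier M \<Longrightarrow> untwist M m \<in> carrier M"
  "h \<in> carrier H \<Longrightarrow> hcomul H h \<in> carrier (H \<boxtimes> H)"
  "m \<in> carrier M \<Longrightarrow> coaction M m \<in> carrier (H \<boxtimes> M)"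
  using structure_homs[THEN hom_closed] by auto

lemma prod_closed [simp]: "\<lbrakk>a \<in> carrier H; b \<in> carrier H\<rbrakk> \<Longrightarrow> hprod K H a b \<in> carrier H"
  by (intro closed_rules module_rules)

lemma act_closed [simp]: "\<lbrakk>h \<in> carrier H; m \<in> carrier M\<rbrakk> \<Longrightarrow> act K H M h m \<in> carrier M"
  by (intro closed_rules module_rules)

lemma twisted_act_closed [simp]:
  "\<lbrakk>h \<in> carrier H; m \<in> carrier M\<rbrakk> \<Longrightarrow> twisted_act K H M h m \<in> carrier M"
  by (simp add: twisted_act_def)

lemma twisted_act_hom_left:
  "\<lbrakk>f \<in> module_hom K Z H; m \<in> carrier M\<rbrakk> \<Longrightarrow> (\<lambda>z. twisted_act K H M (f z) m) \<in> module_hom K Z M"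
  unfolding twisted_act_def by (intro hom_rules module_rules)

lemma twisted_act_hom_right:
  "\<lbrakk>h \<in> carrier H; f \<in> module_hom K Z M\<rbrakk> \<Longrightarrow> (\<lambda>z. twisted_act K H M h (f z)) \<in> module_hom K Z M"
  unfolding twisted_act_def by (intro hom_rules module_rules closed_rules)

lemma untwist_prod:
  "\<lbrakk>a \<in> carrier H; b \<in> carrier H\<rbrakk> \<Longrightarrow>
    untwist H (hprod K H a b) = hprod K H (untwist H a) (untwist H b)"
  using twist_mul[of "untwist H a" "untwist H b"] untwist_simps(2)[OF prod_closed, of "untwist H a" "untwist H b"]
  by simp

lemma untwist_act:
  "\<lbrakk>h \<in> carrier H; m \<in> carrier M\<rbrakk> \<Longrightarrow>
    untwist M (act K H M h m) = act K H M (untwist H h) (untwist M m)"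
  using twist_act[of "untwist H h" "untwist M m"] untwist_simps(4)[OF act_closed, of "untwist H h" "untwist M m"]
  by simp

text \<open>The product \<open>\<alpha>\<^sub>H\<^sup>-\<^sup>1(xy)\<close> on \<open>H\<close> is
  associative in the ordinary sense, and \<open>\<rhd>\<close> is an ordinary action for it. The
  equation is \<open>act_act\<close> with the twists moved to the other side.\<close>

lemma twisted_act_twisted_act:
  assumes "x \<in> carrier H" "y \<in> carrier H" "m \<in> carrier M"
  shows "twisted_act K H M x (twisted_act K H M y m) =
    twisted_act K H M (hprod K H (untwist H x) (untwist H y)) m"
  using assms act_act[of "untwist H (untwist H x)" "untwist H (untwist H y)" "untwist M m"]
  by (simp add: twisted_act_def untwist_act untwist_prod)

text \<open>On pure tensors the inverse twists undo the twists, so \<open>coaction_twist\<close> at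
  \<open>\<alpha>\<^sub>M\<^sup>-\<^sup>1(m)\<close> can be solved for the coaction of that
  element.\<close>

lemma coaction_untwist:
  assumes m: "m \<in> carrier M"
  shows "coaction M (untwist M m) = tmap K H M H M (untwist H) (untwist M) (coaction M m)"
proof -
  have "tmap K H M H M (untwist H) (untwist M) (tmap K H M H M (twist H) (twist M) t) = t"
    if t: "t \<in> carrier (H \<boxtimes> M)" for t
    by (rule tensor_eqI[OF module_axioms M.module_axioms t, where g = "\<lambda>x. x" and V = "H \<boxtimes> M"])
      ((intro hom_rules module_rules)+, simp add: tmap_tens structure_homs module_rules)
  from this[of "coaction M (untwist M m)"] m show ?thesis
    by (simp add: coaction_twist)
qed

lemma comul_untwist:
  assumes h: "h \<in> carrier H"
  shows "tmap K H H H H (twist H) (twist H) (hcomul H (untwist H h)) = hcomul H h"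
  using comul_twist[of "untwist H h"] h by simp

text \<open>With the inner lifts read as tensor products of two linear maps, the rules for
  \<open>tmap\<close> apply to the Yetter-Drinfeld condition.\<close>

lemma yd_compat_tmap:
  assumes "h \<in> carrier H" "m \<in> carrier M"
  shows "tlift K H H (H \<boxtimes> M) (\<lambda>h1 h2. tmap K H M H M (\<lambda>x. hprod K H x (twist H (twist H h2)))
        (\<lambda>m. m) (coaction M (act K H M h1 m))) (hcomul H h) =
    tlift K H H (H \<boxtimes> M) (\<lambda>h1 h2. tmap K H M H M (\<lambda>x. hprod K H (twist H (twist H h1)) (twist H x))
        (\<lambda>m. act K H M (twist H h2) m) (coaction M m)) (hcomul H h)"
  using yd_compat[OF assms] by (simp add: tmap_def)

text \<open>Coassociativity turns \<open>\<alpha>\<^sub>H(m\<^sub>-\<^sub>1)\<close> and the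
  coaction of \<open>m\<^sub>0\<close> into the coproduct of \<open>m\<^sub>-\<^sub>1\<close> and
  \<open>\<alpha>\<^sub>M(m\<^sub>0)\<close>. That last twist cancels one of the two inverse twists,
  so \<open>F\<close> is left applied to a coproduct and a single inverse twist remains on
  \<open>m\<^sub>0\<close>.\<close>

lemma coaction_coaction_hom:
  assumes V: "module K V" and F: "F \<in> module_hom K (H \<boxtimes> H) V" and m: "m \<in> carrier M"
  shows "tmap K (H \<boxtimes> H) M V M F (\<lambda>m. untwist M (untwist M m))
      (tassoc K H H M (tmap K H M H (H \<boxtimes> M) (twist H) (coaction M) (coaction M m))) =
    tmap K H M V M (\<lambda>h. F (hcomul H h)) (untwist M) (coaction M m)"
proof -
  have "tmap K (H \<boxtimes> H) M V M F (\<lambda>m. untwist M (untwist M m))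
      (tmap K H M (H \<boxtimes> H) M (hcomul H) (twist M) t) =
    tmap K H M V M (\<lambda>h. F (hcomul H h)) (untwist M) t" if t: "t \<in> carrier (H \<boxtimes> M)" for t
    by (rule tensor_eqI[OF module_axioms M.module_axioms t, where V = "V \<boxtimes> M"])
      ((intro hom_rules F[THEN hom_compose] F V module_rules)+,
        simp add: tmap_tens structure_homs hom_rules F[THEN hom_compose] F V module_rules)
  from this[of "coaction M m"] m show ?thesis
    by (simp add: coaction_coaction)
qed

end

section \<open>Linearity of the braiding\<close>

locale yd_pair = M: yd_bij K H M + N: yd_bij K H N
  for K :: "('k, 'r) ring_scheme" (structure) and H :: "('k, 'h, 'u) hom_bialg_scheme"
    and M :: "('k, 'h, 'm, 'v) yd_space_scheme" and N :: "('k, 'h, 'n, 'w) yd_space_scheme"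
begin

lemma braiding_tmap:
  "braiding K H M N = tlift K M N (N \<boxtimes> M)
    (\<lambda>m n. tmap K H M N M (\<lambda>h. twisted_act K H N h n) (untwist M) (coaction M m))"
  by (simp add: braiding_def tmap_def twisted_act_def)

lemma braiding_bilinear:
  "bilinear_map K M N (N \<boxtimes> M)
    (\<lambda>m n. tmap K H M N M (\<lambda>h. twisted_act K H N h n) (untwist M) (coaction M m))"
  by (rule bilinear_mapI)
    (intro M.hom_rules tmap_parameter_left M.closed_rules N.twisted_act_hom_left N.twisted_act_hom_right
      M.module_rules N.module_rules; assumption)+

lemma braiding_hom: "braiding K H M N \<in> module_hom K (M \<boxtimes> N) (N \<boxtimes> M)"
  unfolding braiding_tmap by (intro tlift_module_hom braiding_bilinear M.module_rules N.module_rules)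

lemma braiding_tens:
  "\<lbrakk>m \<in> carrier M; n \<in> carrier N\<rbrakk> \<Longrightarrow> braiding K H M N (tens K M N m n) =
    tmap K H M N M (\<lambda>h. twisted_act K H N h n) (untwist M) (coaction M m)"
  unfolding braiding_tmap by (simp add: tlift_tens_eq braiding_bilinear M.module_rules N.module_rules)

end

section \<open>The braid relation\<close>

text \<open>The functions \<open>f\<close> and \<open>f'\<close> agree on the carrier only, so they
  cannot simply be rewritten into each other under \<open>tmap\<close>. Linearity reduces the claim
  to pure tensors, where only values on the carrier occur.\<close>

lemma tmap_cong:
  "\<lbrakk>\<And>x. x \<in> carrier M \<Longrightarrow> f x = f' x; f \<in> module_hom K M M'; f' \<in> module_hom K M M'; g \<in> module_hom K N N';
    module K M; module K N; module K M'; module K N'; t \<in> carrier (M \<boxtimes>\<^bsub>K\<^esub> N)\<rbrakk> \<Longrightarrow>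
    tmap K M N M' N' f g t = tmap K M N M' N' f' g t"
  by (rule tensor_eqI[of K M N t "M' \<boxtimes>\<^bsub>K\<^esub> N'"])
    (simp_all add: tmap_tens tmap_module_hom tensor_modules_module)

locale yd_triple = M: yd_bij K H M + N: yd_bij K H N + P: yd_bij K H P
  for K :: "('k, 'r) ring_scheme" (structure) and H :: "('k, 'h, 'u) hom_bialg_scheme"
    and M :: "('k, 'h, 'm, 'x) yd_space_scheme" and N :: "('k, 'h, 'n, 'y) yd_space_scheme"
    and P :: "('k, 'h, 'p, 'z) yd_space_scheme"
begin

sublocale MN: yd_pair K H M N ..
sublocale MP: yd_pair K H M P ..
sublocale NP: yd_pair K H N P ..

lemmas all_modules = M.module_rules N.module_rules P.module_rules

lemmas braid_homs = MN.braiding_hom MP.braiding_hom NP.braiding_hom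

lemmas linear_rules = M.hom_rules N.hom_rules P.hom_rules braid_homs braid_homs[THEN hom_compose]
  M.twisted_act_hom_left N.twisted_act_hom_left P.twisted_act_hom_left
  M.twisted_act_hom_right N.twisted_act_hom_right P.twisted_act_hom_right
  tmap_left_module_hom tmap_left_module_hom[THEN hom_compose, rotated -1]
  tmap_parameter_left tmap_parameter_right
  M.closed_rules N.closed_rules P.closed_rules all_modules
  M.twisted_act_closed N.twisted_act_closed P.twisted_act_closed

text \<open>The maps \<open>F\<close> arising from the two sides of the braid relation; for the left one
  \<open>u\<close> stands for the coaction of \<open>n\<close>.\<close>

definition left_map :: "'p \<Rightarrow> ('h \<times> 'n \<Rightarrow> 'k) set \<Rightarrow> ('h \<times> 'h \<Rightarrow> 'k) set \<Rightarrow> ('p \<times> 'n \<Rightarrow> 'k) set"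
  where "left_map p u = tlift K H H (P \<boxtimes> N) (\<lambda>a b.
    tmap K H N P N (\<lambda>x. twisted_act K H P (untwist H a) (twisted_act K H P x p))
      (\<lambda>n. twisted_act K H N (untwist H b) (untwist N n)) u)"

definition right_map :: "'n \<Rightarrow> 'p \<Rightarrow> ('h \<times> 'h \<Rightarrow> 'k) set \<Rightarrow> ('p \<times> 'n \<Rightarrow> 'k) set"
  where "right_map n p = tlift K H H (P \<boxtimes> N) (\<lambda>a b.
    tmap K H N P N (\<lambda>x. twisted_act K H P x (twisted_act K H P (untwist H b) p))
      (untwist N) (coaction N (twisted_act K H N (untwist H a) n)))"

lemma left_map_bilinear:
  "\<lbrakk>p \<in> carrier P; u \<in> carrier (H \<boxtimes> N)\<rbrakk> \<Longrightarrow> bilinear_map K H H (P \<boxtimes> N) (\<lambda>a b.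
    tmap K H N P N (\<lambda>x. twisted_act K H P (untwist H a) (twisted_act K H P x p))
      (\<lambda>n. twisted_act K H N (untwist H b) (untwist N n)) u)"
  by (rule bilinear_mapI) (intro linear_rules | assumption)+

lemma right_map_bilinear:
  "\<lbrakk>n \<in> carrier N; p \<in> carrier P\<rbrakk> \<Longrightarrow> bilinear_map K H H (P \<boxtimes> N) (\<lambda>a b.
    tmap K H N P N (\<lambda>x. twisted_act K H P x (twisted_act K H P (untwist H b) p))
      (untwist N) (coaction N (twisted_act K H N (untwist H a) n)))"
  by (rule bilinear_mapI) (intro linear_rules | assumption)+

lemma left_map_hom:
  "\<lbrakk>p \<in> carrier P; u \<in> carrier (H \<boxtimes> N)\<rbrakk> \<Longrightarrow> left_map p u \<in> module_hom K (H \<boxtimes> H) (P \<boxtimes> N)"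
  unfolding left_map_def by (intro tlift_module_hom left_map_bilinear all_modules)

lemma right_map_hom:
  "\<lbrakk>n \<in> carrier N; p \<in> carrier P\<rbrakk> \<Longrightarrow> right_map n p \<in> module_hom K (H \<boxtimes> H) (P \<boxtimes> N)"
  unfolding right_map_def by (intro tlift_module_hom right_map_bilinear all_modules)

text \<open>Linearity in \<open>u\<close> is what later allows the coaction of \<open>n\<close> to
  be replaced by a pure tensor.\<close>

lemma left_map_parameter_hom:
  assumes p: "p \<in> carrier P" and t: "t \<in> carrier (H \<boxtimes> H)"
  shows "(\<lambda>u. left_map p u t) \<in> module_hom K (H \<boxtimes> N) (P \<boxtimes> N)"
  unfolding left_map_def
  by (rule tlift_parameter_hom) (intro linear_rules left_map_bilinear p t | assumption)+

lemma left_map_tens: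
  "\<lbrakk>p \<in> carrier P; u \<in> carrier (H \<boxtimes> N); a \<in> carrier H; b \<in> carrier H\<rbrakk> \<Longrightarrow>
    left_map p u (tens K H H a b) =
    tmap K H N P N (\<lambda>x. twisted_act K H P (untwist H a) (twisted_act K H P x p))
      (\<lambda>n. twisted_act K H N (untwist H b) (untwist N n)) u"
  unfolding left_map_def by (rule tlift_tens_eq) (intro left_map_bilinear all_modules | assumption)+

lemma right_map_tens:
  "\<lbrakk>n \<in> carrier N; p \<in> carrier P; a \<in> carrier H; b \<in> carrier H\<rbrakk> \<Longrightarrow>
    right_map n p (tens K H H a b) =
    tmap K H N P N (\<lambda>x. twisted_act K H P x (twisted_act K H P (untwist H b) p))
      (untwist N) (coaction N (twisted_act K H N (untwist H a) n))"
  unfolding right_map_def by (rule tlift_tens_eq) (intro right_map_bilinear all_modules | assumption)+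

section \<open>The two maps F and the Yetter-Drinfeld condition\<close>

lemma yd_left_bilinear:
  "n \<in> carrier N \<Longrightarrow> bilinear_map K H H (H \<boxtimes> N) (\<lambda>h1 h2.
    tmap K H N H N (\<lambda>x. hprod K H x (twist H (twist H h2))) (\<lambda>n. n) (coaction N (act K H N h1 n)))"
  by (rule bilinear_mapI) (intro linear_rules | assumption)+

lemma yd_right_bilinear:
  "u \<in> carrier (H \<boxtimes> N) \<Longrightarrow> bilinear_map K H H (H \<boxtimes> N) (\<lambda>h1 h2.
    tmap K H N H N (\<lambda>x. hprod K H (twist H (twist H h1)) (twist H x)) (\<lambda>n. act K H N (twist H h2) n) u)"
  by (rule bilinear_mapI) (intro linear_rules | assumption)+

text \<open>The two layers of twists clear the inverse twists on \<open>h1\<close> and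
  \<open>h2\<close>. For \<open>u = x \<otimes> n\<close>, the first factors agree since
  \<open>\<alpha>\<^sub>H(h1) \<rhd> (x \<rhd> p)\<close> and the other side are both
  \<open>(h1 \<alpha>\<^sub>H\<^sup>-\<^sup>1(x)) \<rhd> p\<close>. Both second factors are
  \<open>\<alpha>\<^sub>N\<^sup>-\<^sup>2(\<alpha>\<^sub>H(h2) \<cdot> n)\<close>. When
  \<open>u\<close> is the coaction of \<open>n\<close>, the inner lift is the right side of the
  Yetter-Drinfeld condition.\<close>

lemma left_map_twist:
  assumes p: "p \<in> carrier P" and u: "u \<in> carrier (H \<boxtimes> N)" and t: "t \<in> carrier (H \<boxtimes> H)"
  shows "left_map p u (tmap K H H H H (twist H) (twist H) (tmap K H H H H (twist H) (twist H) t)) =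
    tmap K H N P N (\<lambda>x. twisted_act K H P (untwist H (untwist H x)) p) (\<lambda>n. untwist N (untwist N n))
      (tlift K H H (H \<boxtimes> N) (\<lambda>h1 h2. tmap K H N H N
        (\<lambda>x. hprod K H (twist H (twist H h1)) (twist H x)) (\<lambda>n. act K H N (twist H h2) n) u) t)"
proof (rule tensor_eqI[OF _ _ t, where V = "P \<boxtimes> N"])
  fix h1 h2 assume h: "h1 \<in> carrier H" "h2 \<in> carrier H"
  have "tmap K H N P N (\<lambda>x. twisted_act K H P (twist H h1) (twisted_act K H P x p))
      (\<lambda>n. twisted_act K H N (twist H h2) (untwist N n)) u =
    tmap K H N P N (\<lambda>x. twisted_act K H P (untwist H (untwist H x)) p) (\<lambda>n. untwist N (untwist N n))
      (tmap K H N H N (\<lambda>x. hprod K H (twist H (twist H h1)) (twist H x)) (\<lambda>n. act K H N (twist H h2) n) u)"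
  proof (rule tensor_eqI[OF _ _ u, where V = "P \<boxtimes> N"])
    have homs:
      "(\<lambda>x. twisted_act K H P (twist H h1) (twisted_act K H P x p)) \<in> module_hom K H P"
      "(\<lambda>n. twisted_act K H N (twist H h2) (untwist N n)) \<in> module_hom K N N"
      "(\<lambda>x. twisted_act K H P (untwist H (untwist H x)) p) \<in> module_hom K H P"
      "(\<lambda>n. untwist N (untwist N n)) \<in> module_hom K N N"
      "(\<lambda>x. hprod K H (twist H (twist H h1)) (twist H x)) \<in> module_hom K H H"
      "(\<lambda>n. act K H N (twist H h2) n) \<in> module_hom K N N"
      by (intro linear_rules h p)+
    fix x n assume x: "x \<in> carrier H" "n \<in> carrier N"
    show "tmap K H N P N (\<lambda>x. twisted_act K H P (twist H h1) (twisted_act K H P x p))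
        (\<lambda>n. twisted_act K H N (twist H h2) (untwist N n)) (tens K H N x n) =
      tmap K H N P N (\<lambda>x. twisted_act K H P (untwist H (untwist H x)) p) (\<lambda>n. untwist N (untwist N n))
        (tmap K H N H N (\<lambda>x. hprod K H (twist H (twist H h1)) (twist H x)) (\<lambda>n. act K H N (twist H h2) n)
          (tens K H N x n))"
      using h p x by (simp add: tmap_tens homs all_modules)
        (simp add: P.twisted_act_twisted_act N.untwist_act P.untwist_prod twisted_act_def[of K H N])
  qed (intro linear_rules h p)+
  then show "left_map p u (tmap K H H H H (twist H) (twist H)
      (tmap K H H H H (twist H) (twist H) (tens K H H h1 h2))) =
    tmap K H N P N (\<lambda>x. twisted_act K H P (untwist H (untwist H x)) p) (\<lambda>n. untwist N (untwist N n))
      (tlift K H H (H \<boxtimes> N) (\<lambda>h1 h2. tmap K H N H N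
        (\<lambda>x. hprod K H (twist H (twist H h1)) (twist H x)) (\<lambda>n. act K H N (twist H h2) n) u)
        (tens K H H h1 h2))"
    using h p u by (simp add: tmap_tens M.structure_homs all_modules left_map_tens tlift_tens_eq yd_right_bilinear)
qed (intro linear_rules p left_map_hom[OF p u, THEN hom_compose] yd_right_bilinear[OF u]
    tlift_module_hom[OF _ _ _ yd_right_bilinear[OF u], THEN hom_compose])+

text \<open>The counterpart of \<open>left_map_twist\<close> for the left side of the
  Yetter-Drinfeld condition. On \<open>x \<otimes> n\<close> both first factors become
  \<open>(\<alpha>\<^sub>H\<^sup>-\<^sup>2(x) h2) \<rhd> p\<close>.\<close>

lemma right_map_twist:
  assumes n: "n \<in> carrier N" and p: "p \<in> carrier P" and t: "t \<in> carrier (H \<boxtimes> H)"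
  shows "right_map n p (tmap K H H H H (twist H) (twist H) (tmap K H H H H (twist H) (twist H) t)) =
    tmap K H N P N (\<lambda>x. twisted_act K H P (untwist H (untwist H x)) p) (\<lambda>n. untwist N (untwist N n))
      (tlift K H H (H \<boxtimes> N) (\<lambda>h1 h2. tmap K H N H N (\<lambda>x. hprod K H x (twist H (twist H h2)))
        (\<lambda>n. n) (coaction N (act K H N h1 n))) t)"
proof (rule tensor_eqI[OF _ _ t, where V = "P \<boxtimes> N"])
  fix h1 h2 assume h: "h1 \<in> carrier H" "h2 \<in> carrier H"
  \<comment> \<open>Here \<open>w\<close> stands for the coaction of \<open>h1 \<cdot> n\<close>. As
    that tensor need not be pure, the claim is proved for every \<open>w\<close>, where linearity is
    available.\<close>
  have "tmap K H N P N (\<lambda>x. twisted_act K H P x (twisted_act K H P (twist H h2) p)) (untwist N)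
      (tmap K H N H N (untwist H) (untwist N) w) =
    tmap K H N P N (\<lambda>x. twisted_act K H P (untwist H (untwist H x)) p) (\<lambda>n. untwist N (untwist N n))
      (tmap K H N H N (\<lambda>x. hprod K H x (twist H (twist H h2))) (\<lambda>n. n) w)"
    if w: "w \<in> carrier (H \<boxtimes> N)" for w
  proof (rule tensor_eqI[OF _ _ w, where V = "P \<boxtimes> N"])
    have homs:
      "(\<lambda>x. twisted_act K H P x (twisted_act K H P (twist H h2) p)) \<in> module_hom K H P"
      "(\<lambda>x. twisted_act K H P (untwist H (untwist H x)) p) \<in> module_hom K H P"
      "(\<lambda>n. untwist N (untwist N n)) \<in> module_hom K N N"
      "(\<lambda>x. hprod K H x (twist H (twist H h2))) \<in> module_hom K H H"
      by (intro linear_rules h p)+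
    fix x n assume "x \<in> carrier H" "n \<in> carrier N"
    then show "tmap K H N P N (\<lambda>x. twisted_act K H P x (twisted_act K H P (twist H h2) p)) (untwist N)
        (tmap K H N H N (untwist H) (untwist N) (tens K H N x n)) =
      tmap K H N P N (\<lambda>x. twisted_act K H P (untwist H (untwist H x)) p) (\<lambda>n. untwist N (untwist N n))
        (tmap K H N H N (\<lambda>x. hprod K H x (twist H (twist H h2))) (\<lambda>n. n) (tens K H N x n))"
      using h p by (simp add: tmap_tens homs hom_id N.untwist_hom all_modules
          P.twisted_act_twisted_act P.untwist_prod)
  qed (intro linear_rules h p)+
  moreover have "coaction N (twisted_act K H N (twist H h1) n) =
      tmap K H N H N (untwist H) (untwist N) (coaction N (act K H N h1 n))"
    using h n by (simp add: twisted_act_def N.coaction_untwist)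
  ultimately show "right_map n p (tmap K H H H H (twist H) (twist H)
      (tmap K H H H H (twist H) (twist H) (tens K H H h1 h2))) =
    tmap K H N P N (\<lambda>x. twisted_act K H P (untwist H (untwist H x)) p) (\<lambda>n. untwist N (untwist N n))
      (tlift K H H (H \<boxtimes> N) (\<lambda>h1 h2. tmap K H N H N (\<lambda>x. hprod K H x (twist H (twist H h2)))
        (\<lambda>n. n) (coaction N (act K H N h1 n))) (tens K H H h1 h2))"
    using h n p by (simp add: tmap_tens M.structure_homs all_modules right_map_tens tlift_tens_eq yd_left_bilinear)
qed (intro linear_rules p right_map_hom[OF n p, THEN hom_compose]
    tlift_module_hom[OF _ _ _ yd_left_bilinear[OF n], THEN hom_compose])+

lemma left_map_eq_right_map:
  assumes "n \<in> carrier N" "p \<in> carrier P" "h \<in> carrier H"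
  shows "left_map p (coaction N n) (hcomul H h) = right_map n p (hcomul H h)"
  \<comment> \<open>Both rules are taken at the coproduct of
    \<open>g = \<alpha>\<^sub>H\<^sup>-\<^sup>2(h)\<close>; two uses of \<open>comul_untwist\<close>
    restore the coproduct of \<open>h\<close>.\<close>
  using left_map_twist[of p "coaction N n" "hcomul H (untwist H (untwist H h))"]
    right_map_twist[of n p "hcomul H (untwist H (untwist H h))"] assms
  by (simp add: M.comul_untwist N.yd_compat_tmap)

section \<open>Evaluation of both sides of the braid relation on pure tensors\<close>

lemmas tens_simps = tmap_tens tassoc_tens tassoc'_tens tmap_left_tens all_modules
  hom_id M.structure_homs N.structure_homs P.structure_homs braid_homs
  MN.braiding_tens MP.braiding_tens NP.braiding_tens
  tens_carrier

text \<open>The first braiding yields \<open>m\<^sub>-\<^sub>1 \<rhd> p\<close> and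
  \<open>\<alpha>\<^sub>M\<^sup>-\<^sup>1(m\<^sub>0)\<close>; the second coacts on the latter, so
  \<open>coaction_untwist\<close> produces \<open>\<alpha>\<^sub>M\<^sup>-\<^sup>2\<close> on the
  last factor. Writing \<open>m\<^sub>-\<^sub>1\<close> as
  \<open>\<alpha>\<^sub>H\<^sup>-\<^sup>1(\<alpha>\<^sub>H(m\<^sub>-\<^sub>1))\<close> gives the
  form to which \<open>coaction_coaction_hom\<close> applies.\<close>

lemma braid_left_tens:
  assumes m: "m \<in> carrier M" and n: "n \<in> carrier N" and p: "p \<in> carrier P"
  shows "tmap K P (M \<boxtimes> N) P (N \<boxtimes> M) (\<lambda>x. x) (braiding K H M N)
      (tmap_left K M P P M N (braiding K H M P) (tens K M (P \<boxtimes> N) m (tens K P N p n))) =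
    tassoc' K P N M (tmap K H M (P \<boxtimes> N) M
      (\<lambda>h. tmap K H H P N (\<lambda>a. twisted_act K H P (untwist H a) p)
        (\<lambda>b. twisted_act K H N (untwist H b) n) (hcomul H h)) (untwist M) (coaction M m))"
proof -
  let ?S3 = "tmap K P (M \<boxtimes> N) P (N \<boxtimes> M) (\<lambda>x. x) (braiding K H M N)"
  let ?S2 = "tmap_left K M P P M N (braiding K H M P)"
  let ?F = "tmap K H H P N (\<lambda>a. twisted_act K H P (untwist H a) p)
    (\<lambda>b. twisted_act K H N (untwist H b) n)"
  have act_homs: "(\<lambda>h. twisted_act K H P h p) \<in> module_hom K H P"
    "(\<lambda>h. twisted_act K H N h n) \<in> module_hom K H N"
    "(\<lambda>h. twisted_act K H P (untwist H h) p) \<in> module_hom K H P"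
    "(\<lambda>h. twisted_act K H N (untwist H h) n) \<in> module_hom K H N"
    "(\<lambda>m. untwist M (untwist M m)) \<in> module_hom K M M"
    by (intro linear_rules n p)+
  have F: "?F \<in> module_hom K (H \<boxtimes> H) (P \<boxtimes> N)" by (intro linear_rules n p)+
  \<comment> \<open>The coactions are replaced by arbitrary tensors, innermost first:
    \<open>w\<close> stands for the coaction of \<open>m\<^sub>0\<close>, and \<open>v\<close> in
    the next step for that of \<open>m\<close>. Each claim is then linear in its variable.\<close>
  have *: "tens K P (N \<boxtimes> M) (twisted_act K H P y p) (tmap K H M N M (\<lambda>h. twisted_act K H N h n) (untwist M)
        (tmap K H M H M (untwist H) (untwist M) w)) =
      tassoc' K P N M (tmap K (H \<boxtimes> H) M (P \<boxtimes> N) M ?F (\<lambda>m. untwist M (untwist M m))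
        (tassoc K H H M (tens K H (H \<boxtimes> M) (twist H y) w)))"
    if y: "y \<in> carrier H" and w: "w \<in> carrier (H \<boxtimes> M)" for y w
    by (rule tensor_eqI[OF _ _ w, where V = "P \<boxtimes> N \<boxtimes> M"])
      (use y n p in \<open>simp_all add: tens_simps act_homs F\<close>, (intro linear_rules F[THEN hom_compose] n p y)+)
  have "?S3 (tassoc' K P M N (tens K (P \<boxtimes> M) N
        (tmap K H M P M (\<lambda>h. twisted_act K H P h p) (untwist M) v) n)) =
      tassoc' K P N M (tmap K (H \<boxtimes> H) M (P \<boxtimes> N) M ?F (\<lambda>m. untwist M (untwist M m))
        (tassoc K H H M (tmap K H M H (H \<boxtimes> M) (twist H) (coaction M) v)))"
    if v: "v \<in> carrier (H \<boxtimes> M)" for v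
    by (rule tensor_eqI[OF _ _ v, where V = "P \<boxtimes> N \<boxtimes> M"])
      (use n p in \<open>simp_all add: tens_simps act_homs F * M.coaction_untwist\<close>,
        (intro linear_rules F[THEN hom_compose] n p)+)
  from this[of "coaction M m"] m n p show ?thesis
    by (simp add: tens_simps M.coaction_coaction_hom[OF _ F])
qed

text \<open>For pure \<open>u\<close> the map F is itself a tensor product of two maps, which is the
  form that \<open>braid_left_tens\<close> delivers.\<close>

lemma left_map_tens_right:
  assumes "p \<in> carrier P" "x \<in> carrier H" "n \<in> carrier N" and t: "t \<in> carrier (H \<boxtimes> H)"
  shows "left_map p (tens K H N x n) t =
    tmap K H H P N (\<lambda>a. twisted_act K H P (untwist H a) (twisted_act K H P x p))
      (\<lambda>b. twisted_act K H N (untwist H b) (untwist N n)) t"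
proof (rule tensor_eqI[OF _ _ t, where V = "P \<boxtimes> N"])
  fix a b assume "a \<in> carrier H" "b \<in> carrier H"
  moreover from this assms have
    "(\<lambda>a. twisted_act K H P (untwist H a) (twisted_act K H P x p)) \<in> module_hom K H P"
    "(\<lambda>b. twisted_act K H N (untwist H b) (untwist N n)) \<in> module_hom K H N"
    "(\<lambda>x. twisted_act K H P (untwist H a) (twisted_act K H P x p)) \<in> module_hom K H P"
    "(\<lambda>n. twisted_act K H N (untwist H b) (untwist N n)) \<in> module_hom K N N"
    by - (intro linear_rules | assumption)+
  ultimately show "left_map p (tens K H N x n) (tens K H H a b) =
    tmap K H H P N (\<lambda>a. twisted_act K H P (untwist H a) (twisted_act K H P x p))
      (\<lambda>b. twisted_act K H N (untwist H b) (untwist N n)) (tens K H H a b)"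
    using assms by (simp add: left_map_tens tens_simps)
qed (intro linear_rules left_map_hom assms)+

text \<open>The braiding of \<open>n\<close> with \<open>p\<close> yields \<open>x \<rhd> p\<close>
  and \<open>\<alpha>\<^sub>N\<^sup>-\<^sup>1(n\<^sub>0)\<close>, with
  \<open>x \<otimes> n\<^sub>0\<close> from the coaction of \<open>n\<close>. That coaction is
  generalised to \<open>u\<close>; for pure \<open>u\<close> the claim is
  \<open>braid_left_tens\<close> at these two elements.\<close>

lemma braid_left:
  assumes m: "m \<in> carrier M" and n: "n \<in> carrier N" and p: "p \<in> carrier P"
  shows "tmap K P (M \<boxtimes> N) P (N \<boxtimes> M) (\<lambda>x. x) (braiding K H M N)
      (tmap_left K M P P M N (braiding K H M P)
        (tmap K M (N \<boxtimes> P) M (P \<boxtimes> N) (\<lambda>x. x) (braiding K H N P) (tens K M (N \<boxtimes> P) m (tens K N P n p)))) =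
    tassoc' K P N M (tmap K H M (P \<boxtimes> N) M
      (\<lambda>h. left_map p (coaction N n) (hcomul H h)) (untwist M) (coaction M m))"
proof -
  let ?S3 = "tmap K P (M \<boxtimes> N) P (N \<boxtimes> M) (\<lambda>x. x) (braiding K H M N)"
  let ?S2 = "tmap_left K M P P M N (braiding K H M P)"
  have act_hom: "(\<lambda>h. twisted_act K H P h p) \<in> module_hom K H P" by (intro linear_rules p)+
  have "?S3 (?S2 (tens K M (P \<boxtimes> N) m
        (tmap K H N P N (\<lambda>h. twisted_act K H P h p) (untwist N) u))) =
      tassoc' K P N M (tmap K H M (P \<boxtimes> N) M
        (\<lambda>h. left_map p u (hcomul H h)) (untwist M) (coaction M m))"
    if u: "u \<in> carrier (H \<boxtimes> N)" for u
  proof (rule tensor_eqI[OF _ _ u, where V = "P \<boxtimes> N \<boxtimes> M"])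
    fix x n assume x: "x \<in> carrier H" "n \<in> carrier N"
    have "tmap K H M (P \<boxtimes> N) M (\<lambda>h. left_map p (tens K H N x n) (hcomul H h)) (untwist M) (coaction M m) =
      tmap K H M (P \<boxtimes> N) M
        (\<lambda>h. tmap K H H P N (\<lambda>a. twisted_act K H P (untwist H a) (twisted_act K H P x p))
          (\<lambda>b. twisted_act K H N (untwist H b) (untwist N n)) (hcomul H h)) (untwist M) (coaction M m)"
      by (rule tmap_cong) (use x p in \<open>simp add: left_map_tens_right\<close>,
          (intro linear_rules left_map_hom[THEN hom_compose] p x m)+)
    with x p m show "?S3 (?S2 (tens K M (P \<boxtimes> N) m
        (tmap K H N P N (\<lambda>h. twisted_act K H P h p) (untwist N) (tens K H N x n)))) =
      tassoc' K P N M (tmap K H M (P \<boxtimes> N) M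
        (\<lambda>h. left_map p (tens K H N x n) (hcomul H h)) (untwist M) (coaction M m))"
      using braid_left_tens[of m "untwist N n" "twisted_act K H P x p"] by (simp add: tens_simps act_hom)
  qed (intro linear_rules left_map_hom[THEN hom_compose] left_map_parameter_hom p m | assumption)+
  from this[of "coaction N n"] m n p show ?thesis
    by (simp add: tens_simps)
qed

text \<open>The first two braidings coact on \<open>m\<close> and then on
  \<open>\<alpha>\<^sub>M\<^sup>-\<^sup>1(m\<^sub>0)\<close>, as on the left. The third coacts on
  \<open>m\<^sub>-\<^sub>1 \<rhd> n\<close>; this coaction stays unexpanded inside
  \<open>right_map\<close>, so no reduction to pure tensors in \<open>H \<otimes> N\<close> is
  needed.\<close>

lemma braid_right:
  assumes m: "m \<in> carrier M" and n: "n \<in> carrier N" and p: "p \<in> carrier P"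
  shows "tmap_left K N P P N M (braiding K H N P)
      (tmap K N (M \<boxtimes> P) N (P \<boxtimes> M) (\<lambda>x. x) (braiding K H M P)
        (tmap_left K M N N M P (braiding K H M N) (tens K M (N \<boxtimes> P) m (tens K N P n p)))) =
    tassoc' K P N M (tmap K H M (P \<boxtimes> N) M
      (\<lambda>h. right_map n p (hcomul H h)) (untwist M) (coaction M m))"
proof -
  let ?S3 = "tmap_left K N P P N M (braiding K H N P)"
  let ?S2 = "tmap K N (M \<boxtimes> P) N (P \<boxtimes> M) (\<lambda>x. x) (braiding K H M P)"
  have act_homs: "(\<lambda>h. twisted_act K H P h p) \<in> module_hom K H P"
    "(\<lambda>h. twisted_act K H N h n) \<in> module_hom K H N"
    "(\<lambda>m. untwist M (untwist M m)) \<in> module_hom K M M"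
    by (intro linear_rules n p)+
  note G = right_map_hom[OF n p]
  have *: "?S3 (tens K N (P \<boxtimes> M) (twisted_act K H N y n) (tmap K H M P M (\<lambda>h. twisted_act K H P h p) (untwist M)
        (tmap K H M H M (untwist H) (untwist M) w))) =
      tassoc' K P N M (tmap K (H \<boxtimes> H) M (P \<boxtimes> N) M (right_map n p) (\<lambda>m. untwist M (untwist M m))
        (tassoc K H H M (tens K H (H \<boxtimes> M) (twist H y) w)))"
    if y: "y \<in> carrier H" and w: "w \<in> carrier (H \<boxtimes> M)" for y w
    by (rule tensor_eqI[OF _ _ w, where V = "P \<boxtimes> N \<boxtimes> M"])
      (use y n p in \<open>simp_all add: tens_simps act_homs G right_map_tens\<close>,
        (intro linear_rules G[THEN hom_compose] n p y)+)
  have "?S3 (?S2 (tassoc' K N M P (tens K (N \<boxtimes> M) P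
        (tmap K H M N M (\<lambda>h. twisted_act K H N h n) (untwist M) v) p))) =
      tassoc' K P N M (tmap K (H \<boxtimes> H) M (P \<boxtimes> N) M (right_map n p) (\<lambda>m. untwist M (untwist M m))
        (tassoc K H H M (tmap K H M H (H \<boxtimes> M) (twist H) (coaction M) v)))"
    if v: "v \<in> carrier (H \<boxtimes> M)" for v
    by (rule tensor_eqI[OF _ _ v, where V = "P \<boxtimes> N \<boxtimes> M"])
      (use n p in \<open>simp_all add: tens_simps act_homs G * M.coaction_untwist\<close>,
        (intro linear_rules G[THEN hom_compose] n p)+)
  from this[of "coaction M m"] m n p show ?thesis
    by (simp add: tens_simps M.coaction_coaction_hom[OF _ G])
qed

lemma braid_relation:
  assumes t: "t \<in> carrier (M \<boxtimes> N \<boxtimes> P)"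
  shows "tmap K P (M \<boxtimes> N) P (N \<boxtimes> M) (\<lambda>x. x) (braiding K H M N)
      (tmap_left K M P P M N (braiding K H M P)
        (tmap K M (N \<boxtimes> P) M (P \<boxtimes> N) (\<lambda>x. x) (braiding K H N P) t)) =
    tmap_left K N P P N M (braiding K H N P)
      (tmap K N (M \<boxtimes> P) N (P \<boxtimes> M) (\<lambda>x. x) (braiding K H M P)
        (tmap_left K M N N M P (braiding K H M N) t))"
    (is "?L t = ?R t")
proof (rule tensor_eqI[OF _ _ t, where V = "P \<boxtimes> N \<boxtimes> M"])
  fix m u assume m: "m \<in> carrier M" and u: "u \<in> carrier (N \<boxtimes> P)"
  show "?L (tens K M (N \<boxtimes> P) m u) = ?R (tens K M (N \<boxtimes> P) m u)"
  \<comment> \<open>The triple product is nested to the right, so its second factor \<open>u\<close>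
    must be reduced to pure tensors as well.\<close>
  proof (rule tensor_eqI[OF _ _ u, where V = "P \<boxtimes> N \<boxtimes> M"])
    fix n p assume n: "n \<in> carrier N" and p: "p \<in> carrier P"
    have "tmap K H M (P \<boxtimes> N) M (\<lambda>h. left_map p (coaction N n) (hcomul H h)) (untwist M) (coaction M m) =
        tmap K H M (P \<boxtimes> N) M (\<lambda>h. right_map n p (hcomul H h)) (untwist M) (coaction M m)"
      by (rule tmap_cong) (use n p in \<open>simp add: left_map_eq_right_map\<close>,
          (intro linear_rules left_map_hom[THEN hom_compose] right_map_hom[THEN hom_compose] n p m)+)
    then show "?L (tens K M (N \<boxtimes> P) m (tens K N P n p)) = ?R (tens K M (N \<boxtimes> P) m (tens K N P n p))"
      using braid_left[OF m n p] braid_right[OF m n p] by simp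
  qed (intro linear_rules m)+
qed (intro linear_rules)+

end

theorem theorem3p5:
  fixes K :: "('k, 'r) ring_scheme" (structure)
    and H :: "('k, 'h, 'u) hom_bialg_scheme"
    and M :: "('k, 'h, 'm, 'x) yd_space_scheme"
    and N :: "('k, 'h, 'n, 'y) yd_space_scheme"
    and P :: "('k, 'h, 'p, 'z) yd_space_scheme"
  assumes "field K"
    and "hom_bialgebra K H"
    and "bij_betw (twist H) (carrier H) (carrier H)"
    and "yd_object K H M" and "yd_object K H N" and "yd_object K H P"
  shows "\<forall>t \<in> carrier (M \<boxtimes> N \<boxtimes> P).
    (tmap K P (M \<boxtimes> N) P (N \<boxtimes> M) id (braiding K H M N)
      \<circ> tmap_left K M P P M N (braiding K H M P)
      \<circ> tmap K M (N \<boxtimes> P) M (P \<boxtimes> N) id (braiding K H N P)) t =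
    (tmap_left K N P P N M (braiding K H N P)
      \<circ> tmap K N (M \<boxtimes> P) N (P \<boxtimes> M) id (braiding K H M P)
      \<circ> tmap_left K M N N M P (braiding K H M N)) t"
proof -
  interpret yd_triple K H M N P
    by (intro yd_triple.intro yd_bij.intro yd_bij_axioms.intro assms)
  show ?thesis
    unfolding id_def comp_def using braid_relation by blast
qed

end
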